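(* For every $m\ge1$ and every $1\le p<\infty$, $$\mathfrak{G}_p:=\inf\{F_p(\Omega):\Omega \text{ open in }\mathbb{R}^m,\ 0<|\Omega|<\infty\}=0.$$
   Context: For a non-empty open $\Omega\subset\mathbb{R}^m$ with $|\Omega|<\infty$, $\lambda_1(\Omega)=\inf_{\varphi\in H_0^1(\Omega)\setminus\{0\}}\int_\Omega|D\varphi|^2/\int_\Omega\varphi^2$, $v_\Omega$ is the unique solution of $-\Delta v=1$, $v\in H_0^1(\Omega)$, and $F_p(\Omega)=\|v_\Omega\|_{L^p(\Omega)}\lambda_1(\Omega)/|\Omega|^{1/p}$. *)

theory Defs
  imports "HOL-Analysis.Analysis"
begin

text \<open>Infinitely differentiable real functions on a Euclidean space (greatest fixed point:
  f is differentiable everywhere and every directional derivative is again C-infinity).\<close>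
definition smooth_fun :: "('a::euclidean_space \<Rightarrow> real) \<Rightarrow> bool" where
  "smooth_fun f \<longleftrightarrow> (\<exists>S. f \<in> S \<and>
     (\<forall>g\<in>S. \<exists>g'. (\<forall>x. (g has_derivative g' x) (at x)) \<and> (\<forall>v. (\<lambda>x. g' x v) \<in> S)))"

definition test_fun :: "'a::euclidean_space set \<Rightarrow> ('a \<Rightarrow> real) \<Rightarrow> ('a \<Rightarrow> 'a) \<Rightarrow> bool" where
  "test_fun \<Omega> \<phi> G \<longleftrightarrow> smooth_fun \<phi> \<and>
     (\<forall>x. (\<phi> has_derivative (\<lambda>h. G x \<bullet> h)) (at x)) \<and>
     compact (closure {x. \<phi> x \<noteq> 0}) \<and> closure {x. \<phi> x \<noteq> 0} \<subseteq> \<Omega>"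

definition H01 :: "'a::euclidean_space set \<Rightarrow> ('a \<Rightarrow> real) \<Rightarrow> ('a \<Rightarrow> 'a) \<Rightarrow> bool" where
  "H01 \<Omega> u g \<longleftrightarrow>
     u \<in> borel_measurable lebesgue \<and> g \<in> borel_measurable lebesgue \<and>
     integrable lebesgue (\<lambda>x. (u x)\<^sup>2) \<and> integrable lebesgue (\<lambda>x. (norm (g x))\<^sup>2) \<and>
     (\<exists>\<phi> G. (\<forall>n. test_fun \<Omega> (\<phi> n) (G n)) \<and>
        (\<lambda>n. \<integral>x. (\<phi> n x - u x)\<^sup>2 \<partial>lebesgue) \<longlonglongrightarrow> 0 \<and>
        (\<lambda>n. \<integral>x. (norm (G n x - g x))\<^sup>2 \<partial>lebesgue) \<longlonglongrightarrow> 0)"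

definition lambda1 :: "'a::euclidean_space set \<Rightarrow> real" where
  "lambda1 \<Omega> = Inf {(\<integral>x\<in>\<Omega>. (norm (g x))\<^sup>2 \<partial>lebesgue) / (\<integral>x\<in>\<Omega>. (u x)\<^sup>2 \<partial>lebesgue) | u g.
        H01 \<Omega> u g \<and> (\<integral>x\<in>\<Omega>. (u x)\<^sup>2 \<partial>lebesgue) \<noteq> 0}"

text \<open>v (with weak gradient g) is the (weak) solution of -Delta v = 1, v in H_0^1(Omega).\<close>
definition torsion :: "'a::euclidean_space set \<Rightarrow> ('a \<Rightarrow> real) \<Rightarrow> ('a \<Rightarrow> 'a) \<Rightarrow> bool" where
  "torsion \<Omega> v g \<longleftrightarrow> H01 \<Omega> v g \<and>
     (\<forall>\<psi> G. test_fun \<Omega> \<psi> G \<longrightarrow>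
        (\<integral>x\<in>\<Omega>. g x \<bullet> G x \<partial>lebesgue) = (\<integral>x\<in>\<Omega>. \<psi> x \<partial>lebesgue))"

definition Fp_of :: "real \<Rightarrow> 'a::euclidean_space set \<Rightarrow> ('a \<Rightarrow> real) \<Rightarrow> real" where
  "Fp_of p \<Omega> v = ((\<integral>x\<in>\<Omega>. \<bar>v x\<bar> powr p \<partial>lebesgue) powr (1 / p)) * lambda1 \<Omega>
       / (measure lebesgue \<Omega>) powr (1 / p)"

end

theory Submission
  imports Defs
begin

text \<open>
  Take the disjoint union of the unit ball with \<open>j ^ (m + 1)\<close> balls of radius \<open>1 / j\<close>. By domain
  monotonicity its first eigenvalue is at most that of the unit ball, whatever \<open>j\<close> is. The torsion
  function is \<open>(r\<^sup>2 - |x - c|\<^sup>2) / (2 m) \<le> r\<^sup>2\<close> on each ball, so the small balls, of total volume \<open>j\<close>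
  times that of the unit ball, contribute to \<open>\<integral> v\<^sup>p\<close> at most the volume of the unit ball, while the
  volume of the union grows like \<open>j\<close>. Hence \<open>F\<^sub>p = O (j powr (- 1 / p))\<close>.

  The positive part of a smooth function \<open>w\<close> is approximated in \<open>H\<^sub>0\<^sup>1\<close> by test functions \<open>\<eta>\<^sub>k (w)\<close>, where
  \<open>\<eta>\<^sub>k s = (s - 1 / k) exp (- 1 / (k s - 1))\<close> for \<open>s > 1 / k\<close>; note that \<open>0 \<le> \<eta>\<^sub>k' \<le> 1\<close>. The weak equation on a
  ball reduces to \<open>\<integral> \<nabla>\<psi> \<bullet> (x - c) = - m \<integral> \<psi>\<close>, which follows from translation invariance of the
  integral by differentiation.
\<close>

section \<open>Smooth functions\<close>

definition directional_derivatives_in ::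
    "('a::euclidean_space \<Rightarrow> real) \<Rightarrow> ('a \<Rightarrow> real) set \<Rightarrow> bool" where
  "directional_derivatives_in f S \<longleftrightarrow>
     (\<exists>f'. (\<forall>x. (f has_derivative f' x) (at x)) \<and> (\<forall>v. (\<lambda>x. f' x v) \<in> S))"

lemma directional_derivatives_inI:
  assumes "\<And>x. (f has_derivative f' x) (at x)" "\<And>v. (\<lambda>x. f' x v) \<in> S"
  shows "directional_derivatives_in f S"
  unfolding directional_derivatives_in_def by (intro exI[of _ f'] conjI allI assms)

lemma directional_derivatives_in_mono:
  "directional_derivatives_in f S \<Longrightarrow> S \<subseteq> T \<Longrightarrow> directional_derivatives_in f T"
  unfolding directional_derivatives_in_def by blast

lemma smooth_fun_iff:
  "smooth_fun f \<longleftrightarrow> (\<exists>S. f \<in> S \<and> (\<forall>g\<in>S. directional_derivatives_in g S))"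
  by (simp add: smooth_fun_def directional_derivatives_in_def)

lemma smooth_fun_directional_derivatives:
  assumes "smooth_fun f"
  shows "directional_derivatives_in f (Collect smooth_fun)"
proof -
  obtain S where S_closed: "f \<in> S" "\<forall>g\<in>S. directional_derivatives_in g S"
    using assms unfolding smooth_fun_iff by blast
  then have "S \<subseteq> Collect smooth_fun"
    unfolding smooth_fun_iff by blast
  with S_closed show ?thesis
    using directional_derivatives_in_mono by blast
qed

lemma smooth_fun_imp_derivative:
  assumes "smooth_fun f"
  shows "\<exists>f'. (\<forall>x. (f has_derivative f' x) (at x)) \<and> (\<forall>v. smooth_fun (\<lambda>x. f' x v))"
  using smooth_fun_directional_derivatives[OF assms]
  by (simp add: directional_derivatives_in_def)

inductive_set fun_algebra :: "('a \<Rightarrow> real) set \<Rightarrow> ('a \<Rightarrow> real) set" for S where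
  base: "f \<in> S \<Longrightarrow> f \<in> fun_algebra S"
| const: "(\<lambda>_. a) \<in> fun_algebra S"
| add: "f \<in> fun_algebra S \<Longrightarrow> g \<in> fun_algebra S \<Longrightarrow> (\<lambda>x. f x + g x) \<in> fun_algebra S"
| mult: "f \<in> fun_algebra S \<Longrightarrow> g \<in> fun_algebra S \<Longrightarrow> (\<lambda>x. f x * g x) \<in> fun_algebra S"

lemma smooth_fun_coinduct_upto_algebra:
  assumes deriv: "\<And>f. f \<in> S \<Longrightarrow> directional_derivatives_in f (fun_algebra S)"
    and "f \<in> fun_algebra S"
  shows "smooth_fun f"
proof -
  have "directional_derivatives_in g (fun_algebra S)" if "g \<in> fun_algebra S" for g
    using that
  proof induction
    case (base f)
    then show ?case by (rule deriv)
  next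
    case (const a)
    show ?case
      by (rule directional_derivatives_inI[where f'="\<lambda>_ _. 0"]) (auto intro: fun_algebra.const)
  next
    case (add f g)
    then obtain f' g' where
      "\<And>x. (f has_derivative f' x) (at x)" "\<And>v. (\<lambda>x. f' x v) \<in> fun_algebra S"
      "\<And>x. (g has_derivative g' x) (at x)" "\<And>v. (\<lambda>x. g' x v) \<in> fun_algebra S"
      unfolding directional_derivatives_in_def by blast
    then show ?case
      by (intro directional_derivatives_inI[where f'="\<lambda>x h. f' x h + g' x h"]
          has_derivative_add fun_algebra.add)
  next
    case (mult f g)
    then obtain f' g' where
      "\<And>x. (f has_derivative f' x) (at x)" "\<And>v. (\<lambda>x. f' x v) \<in> fun_algebra S"
      "\<And>x. (g has_derivative g' x) (at x)" "\<And>v. (\<lambda>x. g' x v) \<in> fun_algebra S"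
      unfolding directional_derivatives_in_def by blast
    with mult.hyps show ?case
      by (intro directional_derivatives_inI[where f'="\<lambda>x h. f x * g' x h + f' x h * g x"]
          has_derivative_mult fun_algebra.add fun_algebra.mult)
  qed
  with assms(2) show ?thesis
    unfolding smooth_fun_iff by blast
qed

lemma smooth_fun_fun_algebra:
  assumes "f \<in> fun_algebra (Collect smooth_fun)"
  shows "smooth_fun f"
proof (rule smooth_fun_coinduct_upto_algebra[OF _ assms])
  fix g :: "'a \<Rightarrow> real" assume "g \<in> Collect smooth_fun"
  then show "directional_derivatives_in g (fun_algebra (Collect smooth_fun))"
    by (intro directional_derivatives_in_mono[OF smooth_fun_directional_derivatives])
      (auto intro: fun_algebra.base)
qed

lemma smooth_fun_const: "smooth_fun (\<lambda>_. a)"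
  by (rule smooth_fun_fun_algebra) (intro fun_algebra.const)

lemma smooth_fun_add: "smooth_fun f \<Longrightarrow> smooth_fun g \<Longrightarrow> smooth_fun (\<lambda>x. f x + g x)"
  by (rule smooth_fun_fun_algebra) (intro fun_algebra.add fun_algebra.base CollectI)

lemma smooth_fun_mult: "smooth_fun f \<Longrightarrow> smooth_fun g \<Longrightarrow> smooth_fun (\<lambda>x. f x * g x)"
  by (rule smooth_fun_fun_algebra) (intro fun_algebra.mult fun_algebra.base CollectI)

lemma smooth_fun_cmult: "smooth_fun f \<Longrightarrow> smooth_fun (\<lambda>x. a * f x)"
  by (intro smooth_fun_mult smooth_fun_const)

lemma smooth_fun_diff: "smooth_fun f \<Longrightarrow> smooth_fun g \<Longrightarrow> smooth_fun (\<lambda>x. f x - g x)"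
  using smooth_fun_add[OF _ smooth_fun_cmult[of g "-1"], of f] by simp

lemma smooth_fun_sum:
  "(\<And>i. i \<in> I \<Longrightarrow> smooth_fun (f i)) \<Longrightarrow> smooth_fun (\<lambda>x. \<Sum>i\<in>I. f i x)"
  by (induction I rule: infinite_finite_induct) (auto intro: smooth_fun_const smooth_fun_add)

lemma smooth_fun_inner_left: "smooth_fun (\<lambda>x. x \<bullet> v)"
proof (rule smooth_fun_coinduct_upto_algebra[of "{\<lambda>x. x \<bullet> v}"])
  fix f :: "'a \<Rightarrow> real" assume f: "f \<in> {\<lambda>x. x \<bullet> v}"
  have "((\<lambda>x. x \<bullet> v) has_derivative (\<lambda>h. h \<bullet> v)) (at x)" for x
    by (auto intro!: derivative_eq_intros)
  with f show "directional_derivatives_in f (fun_algebra {\<lambda>x. x \<bullet> v})"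
    by (intro directional_derivatives_inI[where f'="\<lambda>_ h. h \<bullet> v"] fun_algebra.const) simp
qed (auto intro: fun_algebra.base)

lemma smooth_fun_ident: "smooth_fun (\<lambda>t. t)"
  using smooth_fun_inner_left[of "1::real"] by simp

lemma smooth_fun_power2_dist: "smooth_fun (\<lambda>x. (dist c x)\<^sup>2)"
proof -
  have "(dist c x)\<^sup>2 = (\<Sum>b\<in>Basis. (x \<bullet> b - c \<bullet> b) * (x \<bullet> b - c \<bullet> b))" for x
    using euclidean_inner[of "x - c" "x - c"]
    by (simp add: dist_norm norm_minus_commute[of c] dot_square_norm inner_diff_left)
  then show ?thesis
    by (simp add: smooth_fun_sum smooth_fun_mult smooth_fun_diff smooth_fun_inner_left
        smooth_fun_const)
qed

lemma smooth_fun_compose: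
  fixes f :: "'a::euclidean_space \<Rightarrow> real" and h :: "real \<Rightarrow> real"
  assumes "smooth_fun h" "smooth_fun f"
  shows "smooth_fun (\<lambda>x. h (f x))"
proof -
  let ?S = "{\<lambda>x. k (f x) |k. smooth_fun k} \<union> Collect smooth_fun"
  have composite_in: "(\<lambda>x. k (f x)) \<in> fun_algebra ?S" if "smooth_fun k" for k
    using that by (intro fun_algebra.base) blast
  have smooth_subset: "Collect smooth_fun \<subseteq> fun_algebra ?S"
    by (auto intro: fun_algebra.base)
  obtain f' where f_deriv: "\<And>x. (f has_derivative f' x) (at x)" "\<And>v. smooth_fun (\<lambda>x. f' x v)"
    using smooth_fun_imp_derivative[OF assms(2)] by blast
  show ?thesis
  proof (rule smooth_fun_coinduct_upto_algebra[of ?S])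
    fix g assume "g \<in> ?S"
    then consider (compose) k where "smooth_fun k" "g = (\<lambda>x. k (f x))" | (smooth) "smooth_fun g"
      by blast
    then show "directional_derivatives_in g (fun_algebra ?S)"
    proof cases
      case (compose k)
      obtain k' where k_deriv: "\<And>t. (k has_derivative k' t) (at t)" "\<And>v. smooth_fun (\<lambda>t. k' t v)"
        using smooth_fun_imp_derivative[OF compose(1)] by blast
      have "k' (f x) (f' x v) = k' (f x) 1 * f' x v" for x v
        using linear_scale[OF has_derivative_linear[OF k_deriv(1)], of "f x" "f' x v" 1] by simp
      then have "(g has_derivative (\<lambda>v. k' (f x) 1 * f' x v)) (at x)" for x
        using has_derivative_compose[OF f_deriv(1) k_deriv(1), of x] compose(2) by simp
      moreover have "(\<lambda>x. k' (f x) 1 * f' x v) \<in> fun_algebra ?S" for v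
        using f_deriv(2) smooth_subset by (intro fun_algebra.mult composite_in k_deriv(2)) blast
      ultimately show ?thesis by (rule directional_derivatives_inI)
    next
      case smooth
      then show ?thesis
        using directional_derivatives_in_mono[OF smooth_fun_directional_derivatives]
          smooth_subset by blast
    qed
  qed (rule composite_in[OF assms(1)])
qed

lemma smooth_fun_continuous_on:
  assumes "smooth_fun f"
  shows "continuous_on A f"
proof -
  obtain f' where "\<And>x. (f has_derivative f' x) (at x)" "\<And>v. smooth_fun (\<lambda>x. f' x v)"
    using smooth_fun_imp_derivative[OF assms] by blast
  then show ?thesis
    by (intro continuous_at_imp_continuous_on ballI has_derivative_continuous)
qed

lemma smooth_fun_gradient_continuous_on:
  assumes "smooth_fun f" and gradient: "\<And>x. (f has_derivative (\<lambda>h. G x \<bullet> h)) (at x)"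
  shows "continuous_on A G"
proof -
  obtain f' where f_deriv: "\<And>x. (f has_derivative f' x) (at x)" "\<And>v. smooth_fun (\<lambda>x. f' x v)"
    using smooth_fun_imp_derivative[OF assms(1)] by blast
  have "G x \<bullet> v = f' x v" for x v
    using has_derivative_unique[OF gradient f_deriv(1)] by metis
  with f_deriv(2) have "continuous_on A (\<lambda>x. G x \<bullet> v)" for v
    by (simp add: smooth_fun_continuous_on)
  then show ?thesis
    by (simp add: continuous_on_componentwise[where f=G])
qed

section \<open>A smooth regularization of the positive part\<close>

definition flat_exp :: "nat \<Rightarrow> real \<Rightarrow> real" where
  "flat_exp k t = (if t \<le> 0 then 0 else inverse t ^ k * exp (- inverse t))"

lemma tendsto_flat_exp_0: "(flat_exp k \<longlongrightarrow> 0) (at 0)"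
proof (rule filterlim_split_at_real)
  have "\<forall>\<^sub>F t in at_left 0. flat_exp k t = 0"
    by (simp add: eventually_at_filter flat_exp_def)
  then show "(flat_exp k \<longlongrightarrow> 0) (at_left 0)"
    by (rule tendsto_eventually)
  have "((\<lambda>t. inverse t ^ k / exp (inverse t)) \<longlongrightarrow> (0::real)) (at_right 0)"
    by (rule filterlim_compose[OF tendsto_power_div_exp_0 filterlim_inverse_at_top_right])
  moreover have "\<forall>\<^sub>F t in at_right 0. inverse t ^ k / exp (inverse t) = flat_exp k t"
    by (simp add: eventually_at_filter flat_exp_def exp_minus divide_inverse)
  ultimately show "(flat_exp k \<longlongrightarrow> 0) (at_right 0)"
    by (rule Lim_transform_eventually)
qed

lemma has_real_derivative_flat_exp:
  "(flat_exp k has_real_derivative flat_exp (k + 2) t - real k * flat_exp (k + 1) t) (at t)"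
proof -
  consider (neg) "t < 0" | (pos) "0 < t" | (zero) "t = 0" by linarith
  then show ?thesis
  proof cases
    case neg
    have "((\<lambda>_. 0) has_real_derivative 0) (at t)" by simp
    then have "(flat_exp k has_real_derivative 0) (at t)"
      by (rule has_field_derivative_transform_within_open[where S="{..<0}"])
        (use neg in \<open>auto simp: flat_exp_def\<close>)
    then show ?thesis using neg by (simp add: flat_exp_def)
  next
    case pos
    have "((\<lambda>t. inverse t ^ k * exp (- inverse t)) has_real_derivative
        flat_exp (k + 2) t - real k * flat_exp (k + 1) t) (at t)"
      using pos
      by (auto intro!: derivative_eq_intros
          simp: flat_exp_def algebra_simps power_eq_if[of "inverse t" k])
    then show ?thesis
      by (rule has_field_derivative_transform_within_open[where S="{0<..}"])
        (use pos in \<open>auto simp: flat_exp_def\<close>)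
  next
    case zero
    have "flat_exp k h / h = flat_exp (k + 1) h" for h
      by (simp add: flat_exp_def divide_inverse)
    moreover have "flat_exp k' 0 = 0" for k'
      by (simp add: flat_exp_def)
    ultimately show ?thesis
      using zero tendsto_flat_exp_0[of "k + 1"] by (simp add: DERIV_def)
  qed
qed

lemma smooth_fun_flat_exp: "smooth_fun (flat_exp k)"
proof (rule smooth_fun_coinduct_upto_algebra[of "range flat_exp"])
  fix f assume "f \<in> range flat_exp"
  then obtain k where f_eq: "f = flat_exp k" by blast
  show "directional_derivatives_in f (fun_algebra (range flat_exp))"
  proof (rule directional_derivatives_inI)
    show "(f has_derivative (\<lambda>v. (flat_exp (k + 2) t + - real k * flat_exp (k + 1) t) * v)) (at t)"
      for t
      using has_real_derivative_flat_exp[of k t] by (simp add: f_eq has_field_derivative_def)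
    show "(\<lambda>t. (flat_exp (k + 2) t + - real k * flat_exp (k + 1) t) * v)
        \<in> fun_algebra (range flat_exp)" for v
      by (intro fun_algebra.add fun_algebra.mult fun_algebra.const fun_algebra.base rangeI)
  qed
qed (auto intro: fun_algebra.base)

definition soft_pos :: "real \<Rightarrow> real \<Rightarrow> real" where
  "soft_pos k s = (s - 1 / k) * flat_exp 0 (k * s - 1)"

definition soft_step :: "real \<Rightarrow> real \<Rightarrow> real" where
  "soft_step k s = flat_exp 0 (k * s - 1) + flat_exp 1 (k * s - 1)"

lemma smooth_fun_soft_pos: "smooth_fun (soft_pos k)"
  unfolding soft_pos_def[abs_def]
  by (intro smooth_fun_mult smooth_fun_diff smooth_fun_cmult smooth_fun_ident smooth_fun_const
      smooth_fun_compose[OF smooth_fun_flat_exp])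

lemma has_real_derivative_soft_pos:
  assumes "0 < k"
  shows "(soft_pos k has_real_derivative soft_step k s) (at s)"
proof -
  let ?t = "k * s - 1"
  have "((\<lambda>s. flat_exp 0 (k * s - 1)) has_real_derivative flat_exp (0 + 2) ?t * k) (at s)"
    by (rule DERIV_cong[OF DERIV_chain2[OF has_real_derivative_flat_exp]])
      (auto intro!: derivative_eq_intros)
  then have "(soft_pos k has_real_derivative
      flat_exp 0 ?t + (s - 1 / k) * (flat_exp (0 + 2) ?t * k)) (at s)"
    unfolding soft_pos_def[abs_def] by (auto intro!: derivative_eq_intros)
  moreover have "(s - 1 / k) * (flat_exp (0 + 2) ?t * k) = ?t * flat_exp (0 + 2) ?t"
    using assms by (simp add: field_simps)
  moreover have "?t * flat_exp (0 + 2) ?t = flat_exp 1 ?t"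
    by (simp add: flat_exp_def power2_eq_square)
  ultimately show ?thesis
    by (simp only: soft_step_def)
qed

lemma soft_pos_eq_0: "0 < k \<Longrightarrow> s \<le> 1 / k \<Longrightarrow> soft_pos k s = 0"
  by (simp add: soft_pos_def flat_exp_def field_simps)

lemma soft_step_eq_0: "0 < k \<Longrightarrow> s \<le> 1 / k \<Longrightarrow> soft_step k s = 0"
  by (simp add: soft_step_def flat_exp_def field_simps)

lemma soft_pos_bounds:
  assumes "0 < k"
  shows "0 \<le> soft_pos k s" "soft_pos k s \<le> max 0 s"
proof -
  have "0 \<le> soft_pos k s \<and> soft_pos k s \<le> max 0 s"
  proof (cases "s \<le> 1 / k")
    case False
    with assms have pos: "0 < s - 1 / k" "0 < k * s - 1"
      by (simp_all add: field_simps)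
    then have "0 \<le> flat_exp 0 (k * s - 1)" "flat_exp 0 (k * s - 1) \<le> 1"
      by (simp_all add: flat_exp_def)
    with pos(1) have "0 \<le> soft_pos k s" "soft_pos k s \<le> s - 1 / k"
      by (simp_all add: soft_pos_def mult_left_le)
    moreover have "s - 1 / k \<le> max 0 s"
      using assms by (intro max.coboundedI2) simp
    ultimately show ?thesis by linarith
  qed (simp add: soft_pos_eq_0 assms)
  then show "0 \<le> soft_pos k s" "soft_pos k s \<le> max 0 s" by simp_all
qed

lemma soft_step_bounds:
  assumes "0 < k"
  shows "0 \<le> soft_step k s" "soft_step k s \<le> indicator {0<..} s"
proof -
  show "0 \<le> soft_step k s"
    by (simp add: soft_step_def flat_exp_def)
  show "soft_step k s \<le> indicator {0<..} s"
  proof (cases "s \<le> 1 / k")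
    case False
    with assms have "0 < s"
      by (intro less_trans[of 0 "1 / k" s]) simp_all
    from False assms have "0 < k * s - 1"
      by (simp add: field_simps)
    then have "soft_step k s = (1 + inverse (k * s - 1)) / exp (inverse (k * s - 1))"
      by (simp add: soft_step_def flat_exp_def exp_minus field_simps)
    also have "\<dots> \<le> 1"
      using exp_ge_add_one_self[of "inverse (k * s - 1)"] by simp
    finally show ?thesis using \<open>0 < s\<close> by simp
  qed (simp add: soft_step_eq_0 assms)
qed

lemma tendsto_flat_exp_at_top: "(flat_exp k \<longlongrightarrow> 0 ^ k) at_top"
proof -
  have "((\<lambda>t::real. inverse t ^ k * exp (- inverse t)) \<longlongrightarrow> 0 ^ k * exp (- 0)) at_top"
    by (intro tendsto_intros tendsto_inverse_0_at_top filterlim_ident)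
  moreover have "\<forall>\<^sub>F t in at_top. inverse t ^ k * exp (- inverse t) = flat_exp k t"
    using eventually_gt_at_top[of 0] by eventually_elim (simp add: flat_exp_def)
  ultimately show ?thesis
    by (auto intro: Lim_transform_eventually)
qed

lemma tendsto_soft:
  shows "((\<lambda>k. soft_pos k s) \<longlongrightarrow> max 0 s) at_top"
    and "((\<lambda>k. soft_step k s) \<longlongrightarrow> indicator {0<..} s) at_top"
proof -
  have "((\<lambda>k. soft_pos k s) \<longlongrightarrow> max 0 s) at_top \<and>
      ((\<lambda>k. soft_step k s) \<longlongrightarrow> indicator {0<..} s) at_top"
  proof (cases "0 < s")
    case True
    then have "filterlim (\<lambda>k. k * s - 1) at_top at_top" by real_asymp
    then have flat: "((\<lambda>k. flat_exp j (k * s - 1)) \<longlongrightarrow> 0 ^ j) at_top" for j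
      by (rule filterlim_compose[OF tendsto_flat_exp_at_top])
    have "((\<lambda>k. s - 1 / k) \<longlongrightarrow> s) at_top" by real_asymp
    then have "((\<lambda>k. soft_pos k s) \<longlongrightarrow> s * 0 ^ 0) at_top"
      unfolding soft_pos_def by (intro tendsto_mult flat)
    moreover have "((\<lambda>k. soft_step k s) \<longlongrightarrow> 0 ^ 0 + 0 ^ 1) at_top"
      unfolding soft_step_def by (intro tendsto_add flat)
    ultimately show ?thesis using True by simp
  next
    case False
    have "\<forall>\<^sub>F k in at_top. soft_pos k s = 0 \<and> soft_step k s = 0"
      using eventually_gt_at_top[of 0]
    proof eventually_elim
      case (elim k)
      then have "s \<le> 1 / k" using False by (auto intro: order_trans[of s 0])
      with elim show ?case by (simp add: soft_pos_eq_0 soft_step_eq_0)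
    qed
    with False show ?thesis
      by (auto intro!: tendsto_eventually elim: eventually_mono)
  qed
  then show "((\<lambda>k. soft_pos k s) \<longlongrightarrow> max 0 s) at_top"
    and "((\<lambda>k. soft_step k s) \<longlongrightarrow> indicator {0<..} s) at_top" by simp_all
qed

section \<open>Square integrable functions\<close>

definition square_integrable ::
    "'a measure \<Rightarrow> ('a \<Rightarrow> 'b::{real_normed_vector, second_countable_topology}) \<Rightarrow> bool" where
  "square_integrable M f \<longleftrightarrow> f \<in> borel_measurable M \<and> integrable M (\<lambda>x. (norm (f x))\<^sup>2)"

definition tendsto_L2 ::
    "'a measure \<Rightarrow> (nat \<Rightarrow> 'a \<Rightarrow> 'b::real_normed_vector) \<Rightarrow> ('a \<Rightarrow> 'b) \<Rightarrow> bool" where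
  "tendsto_L2 M F f \<longleftrightarrow> (\<lambda>n. \<integral>x. (norm (F n x - f x))\<^sup>2 \<partial>M) \<longlonglongrightarrow> 0"

lemma square_integrable_measurable: "square_integrable M f \<Longrightarrow> f \<in> borel_measurable M"
  by (simp add: square_integrable_def)

lemma square_integrable_integrable: "square_integrable M f \<Longrightarrow> integrable M (\<lambda>x. (norm (f x))\<^sup>2)"
  by (simp add: square_integrable_def)

lemma norm_add_power2_le: "(norm (x + y))\<^sup>2 \<le> 2 * (norm x)\<^sup>2 + 2 * (norm y)\<^sup>2"
proof -
  have "(norm (x + y))\<^sup>2 \<le> (norm x + norm y)\<^sup>2"
    by (intro power_mono norm_triangle_ineq norm_ge_zero)
  also have "\<dots> \<le> 2 * (norm x)\<^sup>2 + 2 * (norm y)\<^sup>2"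
    using sum_squares_bound[of "norm x" "norm y"] by (simp add: power2_sum)
  finally show ?thesis .
qed

lemma square_integrable_zero: "square_integrable M (\<lambda>_. 0)"
  by (simp add: square_integrable_def)

lemma square_integrable_add:
  assumes "square_integrable M f" "square_integrable M g"
  shows "square_integrable M (\<lambda>x. f x + g x)"
  unfolding square_integrable_def
proof
  show meas: "(\<lambda>x. f x + g x) \<in> borel_measurable M"
    using assms by (intro borel_measurable_add square_integrable_measurable)
  show "integrable M (\<lambda>x. (norm (f x + g x))\<^sup>2)"
  proof (rule Bochner_Integration.integrable_bound)
    show "integrable M (\<lambda>x. 2 * (norm (f x))\<^sup>2 + 2 * (norm (g x))\<^sup>2)"
      using assms
      by (intro Bochner_Integration.integrable_add integrable_mult_right
          square_integrable_integrable)
  qed (use meas norm_add_power2_le in auto)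
qed

lemma square_integrable_diff:
  assumes "square_integrable M f" "square_integrable M g"
  shows "square_integrable M (\<lambda>x. f x - g x)"
proof -
  have "square_integrable M (\<lambda>x. - g x)"
    using assms(2) by (simp add: square_integrable_def)
  from square_integrable_add[OF assms(1) this] show ?thesis by simp
qed

lemma square_integrable_inner:
  fixes f g :: "'a \<Rightarrow> 'b::euclidean_space"
  assumes "square_integrable M f" "square_integrable M g"
  shows "integrable M (\<lambda>x. f x \<bullet> g x)"
proof (rule Bochner_Integration.integrable_bound)
  show "integrable M (\<lambda>x. (norm (f x))\<^sup>2 + (norm (g x))\<^sup>2)"
    using assms by (intro Bochner_Integration.integrable_add square_integrable_integrable)
  show "(\<lambda>x. f x \<bullet> g x) \<in> borel_measurable M"
    using assms by (intro borel_measurable_inner square_integrable_measurable)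
  show "AE x in M. norm (f x \<bullet> g x) \<le> norm ((norm (f x))\<^sup>2 + (norm (g x))\<^sup>2)"
  proof (rule AE_I2)
    fix x
    have "norm (f x \<bullet> g x) \<le> norm (f x) * norm (g x)"
      using Cauchy_Schwarz_ineq2 by simp
    also have "\<dots> \<le> (norm (f x))\<^sup>2 + (norm (g x))\<^sup>2"
      using sum_squares_bound[of "norm (f x)" "norm (g x)"]
        mult_nonneg_nonneg[OF norm_ge_zero norm_ge_zero, of "f x" "g x"]
      by linarith
    finally show "norm (f x \<bullet> g x) \<le> norm ((norm (f x))\<^sup>2 + (norm (g x))\<^sup>2)" by simp
  qed
qed

lemma tendsto_L2_add:
  assumes "\<And>n. square_integrable M (F n)" "square_integrable M f" "tendsto_L2 M F f"
    and "\<And>n. square_integrable M (G n)" "square_integrable M g" "tendsto_L2 M G g"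
  shows "tendsto_L2 M (\<lambda>n x. F n x + G n x) (\<lambda>x. f x + g x)"
  unfolding tendsto_L2_def
proof (rule tendsto_sandwich[OF _ _ tendsto_const])
  let ?F = "\<lambda>n x. F n x - f x" and ?G = "\<lambda>n x. G n x - g x"
  have diff_integrable: "integrable M (\<lambda>x. (norm (?F n x))\<^sup>2)"
    "integrable M (\<lambda>x. (norm (?G n x))\<^sup>2)" for n
    using assms by (intro square_integrable_integrable square_integrable_diff; simp)+
  show "(\<lambda>n. 2 * (\<integral>x. (norm (?F n x))\<^sup>2 \<partial>M) + 2 * (\<integral>x. (norm (?G n x))\<^sup>2 \<partial>M)) \<longlonglongrightarrow> 0"
    using assms(3,6) unfolding tendsto_L2_def by (auto intro!: tendsto_eq_intros)
  have "(\<integral>x. (norm (F n x + G n x - (f x + g x)))\<^sup>2 \<partial>M)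
      \<le> (\<integral>x. 2 * (norm (?F n x))\<^sup>2 + 2 * (norm (?G n x))\<^sup>2 \<partial>M)" for n
    using norm_add_power2_le[of "?F n x" "?G n x" for x]
    by (intro integral_mono') (auto intro!: diff_integrable simp: algebra_simps)
  then show "\<forall>\<^sub>F n in sequentially. (\<integral>x. (norm (F n x + G n x - (f x + g x)))\<^sup>2 \<partial>M)
      \<le> 2 * (\<integral>x. (norm (?F n x))\<^sup>2 \<partial>M) + 2 * (\<integral>x. (norm (?G n x))\<^sup>2 \<partial>M)"
    by (simp add: diff_integrable)
qed simp

lemma tendsto_L2_AE_eq_0:
  assumes F_sq_integrable: "\<And>n. square_integrable M (F n)"
    and f_sq_integrable: "square_integrable M f"
    and lim: "tendsto_L2 M F f"
    and A_sets: "A \<in> sets M" and zero: "\<And>n x. x \<in> A \<Longrightarrow> F n x = 0"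
  shows "AE x in M. x \<in> A \<longrightarrow> f x = 0"
proof -
  let ?f = "\<lambda>x. indicator A x * (norm (f x))\<^sup>2"
  have indicator_integrable: "integrable M ?f"
    using integrable_mult_indicator[OF A_sets square_integrable_integrable[OF f_sq_integrable]]
    by simp
  have "(\<integral>x. ?f x \<partial>M) \<le> (\<integral>x. (norm (F n x - f x))\<^sup>2 \<partial>M)" for n
  proof (rule integral_mono[OF indicator_integrable])
    show "integrable M (\<lambda>x. (norm (F n x - f x))\<^sup>2)"
      by (intro square_integrable_integrable square_integrable_diff F_sq_integrable f_sq_integrable)
  qed (auto simp: indicator_def zero)
  with lim have "(\<integral>x. ?f x \<partial>M) \<le> 0"
    unfolding tendsto_L2_def by (intro LIMSEQ_le_const) auto
  then have "(\<integral>x. ?f x \<partial>M) = 0"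
    by (intro antisym integral_nonneg_AE) auto
  then have "AE x in M. ?f x = 0"
    using integral_nonneg_eq_0_iff_AE[OF indicator_integrable] by simp
  then show ?thesis
    by eventually_elim (auto simp: indicator_def)
qed

lemma tendsto_L2_dominated:
  assumes F_measurable: "\<And>n. F n \<in> borel_measurable M"
    and f_sq_integrable: "square_integrable M f"
    and bound: "\<And>n x. norm (F n x - f x) \<le> norm (f x)"
    and lim: "\<And>x. (\<lambda>n. F n x) \<longlonglongrightarrow> f x"
  shows "tendsto_L2 M F f"
proof -
  have [measurable]: "f \<in> borel_measurable M" "F n \<in> borel_measurable M" for n
    using f_sq_integrable F_measurable by (simp_all add: square_integrable_measurable)
  have "(\<lambda>n. \<integral>x. (norm (F n x - f x))\<^sup>2 \<partial>M) \<longlonglongrightarrow> (\<integral>x. 0 \<partial>M)"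
  proof (rule integral_dominated_convergence)
    show "integrable M (\<lambda>x. (norm (f x))\<^sup>2)"
      using f_sq_integrable by (rule square_integrable_integrable)
    show "AE x in M. (\<lambda>n. (norm (F n x - f x))\<^sup>2) \<longlonglongrightarrow> 0"
      using LIM_zero[OF lim] by (intro AE_I2 tendsto_null_power tendsto_norm_zero) auto
    show "AE x in M. norm ((norm (F n x - f x))\<^sup>2) \<le> (norm (f x))\<^sup>2" for n
      using bound by (intro AE_I2) (simp add: power_mono)
  qed auto
  then show ?thesis
    by (simp add: tendsto_L2_def)
qed

section \<open>Test functions\<close>

lemma has_derivative_outside_support:
  assumes "(f has_derivative f') (at x)" "x \<notin> closure {x. f x \<noteq> 0}"
  shows "f' = (\<lambda>_. 0)"
proof (rule has_derivative_unique[OF assms(1)])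
  show "(f has_derivative (\<lambda>_. 0)) (at x)"
  proof (rule has_derivative_transform_within_open[OF has_derivative_const])
    show "open (- closure {x. f x \<noteq> 0})" by (intro open_Compl closed_closure)
    show "0 = f y" if "y \<in> - closure {x. f x \<noteq> 0}" for y
      using that closure_subset[of "{x. f x \<noteq> 0}"] by auto
  qed (use assms(2) in simp)
qed

lemma indicator_closure_support_scaleR:
  fixes f :: "'a::topological_space \<Rightarrow> 'b::real_vector"
  shows "indicator (closure {x. f x \<noteq> 0}) x *\<^sub>R f x = f x"
  using closure_subset[of "{x. f x \<noteq> 0}"] by (auto simp: indicator_def)

lemma integrable_continuous_bounded_support:
  fixes f :: "'a::euclidean_space \<Rightarrow> 'b::{banach, second_countable_topology}"
  assumes "continuous_on UNIV f" "bounded {x. f x \<noteq> 0}"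
  shows "integrable lborel f"
proof -
  have "integrable lborel (\<lambda>x. indicator (closure {x. f x \<noteq> 0}) x *\<^sub>R f x)"
    using assms by (intro borel_integrable_compact) (auto intro: continuous_on_subset)
  then show ?thesis by (simp only: indicator_closure_support_scaleR)
qed

lemma test_funI:
  assumes "smooth_fun \<phi>" "\<And>x. (\<phi> has_derivative (\<lambda>h. G x \<bullet> h)) (at x)"
    and compact_subset: "compact K" "K \<subseteq> \<Omega>" and "\<And>x. x \<notin> K \<Longrightarrow> \<phi> x = 0"
  shows "test_fun \<Omega> \<phi> G"
proof -
  have "closure {x. \<phi> x \<noteq> 0} \<subseteq> K"
    using assms(5) compact_subset(1) by (intro closure_minimal compact_imp_closed) auto
  moreover from this compact_subset(1) have "compact (closure {x. \<phi> x \<noteq> 0})"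
    by (metis closed_closure compact_Int_closed inf.absorb2)
  ultimately show ?thesis
    using assms(1,2) compact_subset(2) by (auto simp: test_fun_def)
qed

lemma test_fun_smooth: "test_fun \<Omega> \<phi> G \<Longrightarrow> smooth_fun \<phi>"
  by (simp add: test_fun_def)

lemma test_fun_has_derivative: "test_fun \<Omega> \<phi> G \<Longrightarrow> (\<phi> has_derivative (\<lambda>h. G x \<bullet> h)) (at x)"
  by (simp add: test_fun_def)

lemma test_fun_compact_support: "test_fun \<Omega> \<phi> G \<Longrightarrow> compact (closure {x. \<phi> x \<noteq> 0})"
  by (simp add: test_fun_def)

lemma test_fun_support_subset: "test_fun \<Omega> \<phi> G \<Longrightarrow> closure {x. \<phi> x \<noteq> 0} \<subseteq> \<Omega>"
  by (simp add: test_fun_def)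

lemma test_fun_mono: "test_fun \<Omega> \<phi> G \<Longrightarrow> \<Omega> \<subseteq> \<Omega>' \<Longrightarrow> test_fun \<Omega>' \<phi> G"
  unfolding test_fun_def by blast

lemma test_fun_outside_support:
  assumes "test_fun \<Omega> \<phi> G" "x \<notin> closure {x. \<phi> x \<noteq> 0}"
  shows "\<phi> x = 0" "G x = 0"
proof -
  show "\<phi> x = 0"
    using assms(2) closure_subset[of "{x. \<phi> x \<noteq> 0}"] by auto
  have "(\<lambda>h. G x \<bullet> h) = (\<lambda>_. 0)"
    by (rule has_derivative_outside_support[OF test_fun_has_derivative[OF assms(1)] assms(2)])
  then show "G x = 0"
    by (metis inner_eq_zero_iff)
qed

lemma test_fun_outside:
  assumes "test_fun \<Omega> \<phi> G" "x \<notin> \<Omega>"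
  shows "\<phi> x = 0" "G x = 0"
proof -
  have "x \<notin> closure {x. \<phi> x \<noteq> 0}"
    using test_fun_support_subset[OF assms(1)] assms(2) by (rule contra_subsetD)
  then show "\<phi> x = 0" "G x = 0"
    by (rule test_fun_outside_support[OF assms(1)])+
qed

lemma test_fun_continuous_on:
  assumes "test_fun \<Omega> \<phi> G"
  shows "continuous_on A \<phi>" "continuous_on A G"
  using smooth_fun_continuous_on smooth_fun_gradient_continuous_on
    test_fun_smooth[OF assms] test_fun_has_derivative[OF assms] by blast+

lemma test_fun_bounded_support:
  assumes "test_fun \<Omega> \<phi> G"
  shows "bounded {x. \<phi> x \<noteq> 0}" "bounded {x. G x \<noteq> 0}"
proof -
  have bounded: "bounded (closure {x. \<phi> x \<noteq> 0})"
    using test_fun_compact_support[OF assms] by (rule compact_imp_bounded)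
  show "bounded {x. \<phi> x \<noteq> 0}"
    using bounded closure_subset by (rule bounded_subset)
  have "{x. G x \<noteq> 0} \<subseteq> closure {x. \<phi> x \<noteq> 0}"
    using test_fun_outside_support(2)[OF assms] by blast
  with bounded show "bounded {x. G x \<noteq> 0}"
    by (rule bounded_subset)
qed

lemma square_integrable_indicator_continuous:
  fixes f :: "'a::euclidean_space \<Rightarrow> 'b::euclidean_space"
  assumes "continuous_on UNIV f" "bounded A" and A_sets: "A \<in> sets borel"
  shows "square_integrable lebesgue (\<lambda>x. indicator A x *\<^sub>R f x)"
proof -
  have f_measurable: "f \<in> borel_measurable borel"
    using assms(1) by (rule borel_measurable_continuous_onI)
  have closure_integrable: "integrable lborel (\<lambda>x. indicator (closure A) x *\<^sub>R (norm (f x))\<^sup>2)"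
    using assms(1,2)
    by (intro borel_integrable_compact continuous_intros) (auto intro: continuous_on_subset)
  have "integrable lborel
      (\<lambda>x. indicator A x *\<^sub>R (indicator (closure A) x *\<^sub>R (norm (f x))\<^sup>2))"
    using A_sets by (intro integrable_mult_indicator closure_integrable) simp
  moreover have "indicator A x *\<^sub>R (indicator (closure A) x *\<^sub>R (norm (f x))\<^sup>2)
      = (norm (indicator A x *\<^sub>R f x))\<^sup>2" for x
    using closure_subset[of A] by (auto simp: indicator_def)
  ultimately show ?thesis
    using A_sets f_measurable
    by (simp add: square_integrable_def integrable_completion measurable_completion)
qed

lemma square_integrable_continuous_bounded_support:
  fixes f :: "'a::euclidean_space \<Rightarrow> 'b::euclidean_space"
  assumes "continuous_on UNIV f" "bounded {x. f x \<noteq> 0}"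
  shows "square_integrable lebesgue f"
proof -
  have "square_integrable lebesgue (\<lambda>x. indicator (closure {x. f x \<noteq> 0}) x *\<^sub>R f x)"
    using assms by (intro square_integrable_indicator_continuous) auto
  then show ?thesis by (simp only: indicator_closure_support_scaleR)
qed

lemma test_fun_square_integrable:
  assumes "test_fun \<Omega> \<phi> G"
  shows "square_integrable lebesgue \<phi>" "square_integrable lebesgue G"
  by (rule square_integrable_continuous_bounded_support
      [OF test_fun_continuous_on(1)[OF assms] test_fun_bounded_support(1)[OF assms]],
      rule square_integrable_continuous_bounded_support
      [OF test_fun_continuous_on(2)[OF assms] test_fun_bounded_support(2)[OF assms]])

lemma test_fun_integrable:
  assumes "test_fun \<Omega> \<phi> G"
  shows "integrable lebesgue \<phi>"
proof -
  have "integrable lborel \<phi>"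
    using assms
    by (intro integrable_continuous_bounded_support test_fun_continuous_on test_fun_bounded_support)
  then show ?thesis
    by (simp add: integrable_completion borel_measurable_integrable)
qed

lemma test_fun_zero: "test_fun \<Omega> (\<lambda>_. 0) (\<lambda>_. 0)"
  by (rule test_funI[of _ _ "{}"]) (auto intro: smooth_fun_const)

lemma test_fun_add:
  assumes "test_fun \<Omega> \<phi> G" "test_fun \<Omega> \<psi> H"
  shows "test_fun \<Omega> (\<lambda>x. \<phi> x + \<psi> x) (\<lambda>x. G x + H x)"
proof (rule test_funI)
  let ?K = "closure {x. \<phi> x \<noteq> 0} \<union> closure {x. \<psi> x \<noteq> 0}"
  show "smooth_fun (\<lambda>x. \<phi> x + \<psi> x)"
    using assms by (intro smooth_fun_add test_fun_smooth)
  show "compact ?K"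
    using assms by (intro compact_Un test_fun_compact_support)
  show "?K \<subseteq> \<Omega>"
    using assms by (intro Un_least test_fun_support_subset)
  show "\<phi> x + \<psi> x = 0" if "x \<notin> ?K" for x
  proof -
    have "\<phi> x = 0" "\<psi> x = 0"
      using that assms[THEN test_fun_outside_support(1), of x] by (simp_all only: Un_iff) blast+
    then show ?thesis by simp
  qed
  show "((\<lambda>x. \<phi> x + \<psi> x) has_derivative (\<lambda>h. (G x + H x) \<bullet> h)) (at x)" for x
    using has_derivative_add[OF assms[THEN test_fun_has_derivative]] by (simp add: inner_add_left)
qed

lemma has_derivative_indicator_mult:
  fixes f :: "'a::real_normed_vector \<Rightarrow> real"
  assumes "open U" "open V" "U \<inter> V = {}" and supp: "closure {x. f x \<noteq> 0} \<subseteq> U \<union> V"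
    and f_deriv: "(f has_derivative f') (at x)"
  shows "((\<lambda>x. indicator U x * f x) has_derivative (\<lambda>h. indicator U x * f' h)) (at x)"
proof (cases "x \<in> U")
  case True
  have "((\<lambda>x. indicator U x * f x) has_derivative f') (at x)"
    by (rule has_derivative_transform_within_open[OF f_deriv \<open>open U\<close> True]) simp
  with True show ?thesis by simp
next
  case False
  let ?W = "V \<union> - closure {x. f x \<noteq> 0}"
  have "((\<lambda>x. indicator U x * f x) has_derivative (\<lambda>_. 0)) (at x)"
  proof (rule has_derivative_transform_within_open[OF has_derivative_const])
    show "open ?W" using \<open>open V\<close> by (intro open_Un open_Compl closed_closure)
    show "x \<in> ?W" using False supp by auto
    show "0 = indicator U y * f y" if "y \<in> ?W" for y
      using that assms(3) closure_subset[of "{x. f x \<noteq> 0}"] by (auto simp: indicator_def)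
  qed
  with False show ?thesis by simp
qed

lemma smooth_fun_indicator_mult:
  assumes separated: "open U" "open V" "U \<inter> V = {}"
    and "smooth_fun f" "closure {x. f x \<noteq> 0} \<subseteq> U \<union> V"
  shows "smooth_fun (\<lambda>x. indicator U x * f x)"
proof -
  let ?S = "{\<lambda>x. indicator U x * g x |g. smooth_fun g \<and> closure {x. g x \<noteq> 0} \<subseteq> U \<union> V}"
  show ?thesis
  proof (rule smooth_fun_coinduct_upto_algebra[of ?S])
    fix h assume "h \<in> ?S"
    then obtain g where g_smooth: "smooth_fun g" "closure {x. g x \<noteq> 0} \<subseteq> U \<union> V"
      and h_eq: "h = (\<lambda>x. indicator U x * g x)" by blast
    obtain g' where g_deriv: "\<And>x. (g has_derivative g' x) (at x)" "\<And>v. smooth_fun (\<lambda>x. g' x v)"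
      using smooth_fun_imp_derivative[OF g_smooth(1)] by blast
    have "{x. g' x v \<noteq> 0} \<subseteq> closure {x. g x \<noteq> 0}" for v
      using has_derivative_outside_support[OF g_deriv(1)] by fastforce
    then have "closure {x. g' x v \<noteq> 0} \<subseteq> U \<union> V" for v
      using g_smooth(2) closure_minimal[OF _ closed_closure] by (meson order_trans)
    with g_deriv(2) have "(\<lambda>x. indicator U x * g' x v) \<in> fun_algebra ?S" for v
      by (intro fun_algebra.base CollectI exI[of _ "\<lambda>x. g' x v"] conjI refl)
    with has_derivative_indicator_mult[OF separated g_smooth(2) g_deriv(1)]
    show "directional_derivatives_in h (fun_algebra ?S)"
      unfolding h_eq by (rule directional_derivatives_inI)
  next
    show "(\<lambda>x. indicator U x * f x) \<in> fun_algebra ?S"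
      using assms(4,5) by (intro fun_algebra.base) blast
  qed
qed

lemma test_fun_restrict:
  assumes separated: "open U" "open V" "U \<inter> V = {}" and test: "test_fun (U \<union> V) \<psi> G"
  shows "test_fun U (\<lambda>x. indicator U x * \<psi> x) (\<lambda>x. indicator U x *\<^sub>R G x)"
proof (rule test_funI)
  let ?K = "closure {x. \<psi> x \<noteq> 0}"
  note supp = test_fun_support_subset[OF test]
  show "smooth_fun (\<lambda>x. indicator U x * \<psi> x)"
    by (rule smooth_fun_indicator_mult[OF separated test_fun_smooth[OF test] supp])
  show "((\<lambda>x. indicator U x * \<psi> x) has_derivative (\<lambda>h. (indicator U x *\<^sub>R G x) \<bullet> h)) (at x)" for x
    using has_derivative_indicator_mult[OF separated supp test_fun_has_derivative[OF test]] by simp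
  show "compact (?K - V)"
    using test_fun_compact_support[OF test] separated(2) by (rule compact_diff)
  show "?K - V \<subseteq> U" using supp by blast
  show "indicator U x * \<psi> x = 0" if "x \<notin> ?K - V" for x
    using that separated(3) test_fun_outside_support(1)[OF test, of x] by (auto simp: indicator_def)
qed

section \<open>The Sobolev space\<close>

lemma H01_iff:
  "H01 \<Omega> u g \<longleftrightarrow> square_integrable lebesgue u \<and> square_integrable lebesgue g \<and>
     (\<exists>\<phi> G. (\<forall>n. test_fun \<Omega> (\<phi> n) (G n)) \<and> tendsto_L2 lebesgue \<phi> u \<and> tendsto_L2 lebesgue G g)"
  by (auto simp: H01_def square_integrable_def tendsto_L2_def)

lemma H01I:
  assumes "square_integrable lebesgue u" "square_integrable lebesgue g"
    and "\<And>n. test_fun \<Omega> (\<phi> n) (G n)" "tendsto_L2 lebesgue \<phi> u" "tendsto_L2 lebesgue G g"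
  shows "H01 \<Omega> u g"
  unfolding H01_iff by (intro conjI exI[of _ \<phi>] exI[of _ G] allI assms)

lemma H01_mono:
  assumes "H01 \<Omega> u g" "\<Omega> \<subseteq> \<Omega>'"
  shows "H01 \<Omega>' u g"
  using assms test_fun_mono unfolding H01_iff by meson

lemma H01_zero: "H01 \<Omega> (\<lambda>_. 0) (\<lambda>_. 0)"
  by (rule H01I[OF square_integrable_zero square_integrable_zero test_fun_zero])
    (simp_all add: tendsto_L2_def)

lemma H01_add:
  assumes "H01 \<Omega> u g" "H01 \<Omega> w h"
  shows "H01 \<Omega> (\<lambda>x. u x + w x) (\<lambda>x. g x + h x)"
proof -
  obtain \<phi> G where u_approx: "\<And>n. test_fun \<Omega> (\<phi> n) (G n)"
    "tendsto_L2 lebesgue \<phi> u" "tendsto_L2 lebesgue G g"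
    using assms(1) unfolding H01_iff by blast
  obtain \<psi> H where w_approx: "\<And>n. test_fun \<Omega> (\<psi> n) (H n)"
    "tendsto_L2 lebesgue \<psi> w" "tendsto_L2 lebesgue H h"
    using assms(2) unfolding H01_iff by blast
  have sq_integrable: "square_integrable lebesgue u" "square_integrable lebesgue g"
    "square_integrable lebesgue w" "square_integrable lebesgue h"
    using assms by (simp_all add: H01_iff)
  show ?thesis
  proof (rule H01I)
    show "test_fun \<Omega> (\<lambda>x. \<phi> n x + \<psi> n x) (\<lambda>x. G n x + H n x)" for n
      by (intro test_fun_add u_approx(1) w_approx(1))
    show "tendsto_L2 lebesgue (\<lambda>n x. \<phi> n x + \<psi> n x) (\<lambda>x. u x + w x)"
      by (intro tendsto_L2_add sq_integrable u_approx(2) w_approx(2)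
          test_fun_square_integrable(1)[OF u_approx(1)]
          test_fun_square_integrable(1)[OF w_approx(1)])
    show "tendsto_L2 lebesgue (\<lambda>n x. G n x + H n x) (\<lambda>x. g x + h x)"
      by (intro tendsto_L2_add sq_integrable u_approx(3) w_approx(3)
          test_fun_square_integrable(2)[OF u_approx(1)]
          test_fun_square_integrable(2)[OF w_approx(1)])
  qed (intro square_integrable_add sq_integrable)+
qed

lemma H01_AE_outside:
  assumes "H01 \<Omega> u g" "\<Omega> \<in> sets lebesgue"
  shows "AE x in lebesgue. x \<notin> \<Omega> \<longrightarrow> u x = 0" "AE x in lebesgue. x \<notin> \<Omega> \<longrightarrow> g x = 0"
proof -
  obtain \<phi> G where test: "\<And>n. test_fun \<Omega> (\<phi> n) (G n)"
    and lim: "tendsto_L2 lebesgue \<phi> u" "tendsto_L2 lebesgue G g"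
    using assms(1) unfolding H01_iff by blast
  have sq_integrable: "square_integrable lebesgue u" "square_integrable lebesgue g"
    using assms(1) by (simp_all add: H01_iff)
  have sets: "- \<Omega> \<in> sets lebesgue"
    using sets.compl_sets[OF assms(2)] by (simp add: Compl_eq_Diff_UNIV)
  have zero: "\<phi> n x = 0" "G n x = 0" if "x \<in> - \<Omega>" for n x
    using that by (intro test_fun_outside[OF test]; simp)+
  show "AE x in lebesgue. x \<notin> \<Omega> \<longrightarrow> u x = 0"
    using tendsto_L2_AE_eq_0[OF test_fun_square_integrable(1)[OF test] sq_integrable(1) lim(1)
        sets zero(1)] by simp
  show "AE x in lebesgue. x \<notin> \<Omega> \<longrightarrow> g x = 0"
    using tendsto_L2_AE_eq_0[OF test_fun_square_integrable(2)[OF test] sq_integrable(2) lim(2)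
        sets zero(2)] by simp
qed

lemma test_fun_soft_pos:
  assumes w_smooth: "smooth_fun w" "\<And>x. (w has_derivative (\<lambda>h. W x \<bullet> h)) (at x)"
    and superlevel: "compact {x. 1 / k \<le> w x}" "{x. 0 < w x} \<subseteq> \<Omega>" and k_pos: "0 < k"
  shows "test_fun \<Omega> (\<lambda>x. soft_pos k (w x)) (\<lambda>x. soft_step k (w x) *\<^sub>R W x)"
proof (rule test_funI[OF _ _ superlevel(1)])
  show "smooth_fun (\<lambda>x. soft_pos k (w x))"
    by (rule smooth_fun_compose[OF smooth_fun_soft_pos w_smooth(1)])
  show "((\<lambda>x. soft_pos k (w x)) has_derivative (\<lambda>h. (soft_step k (w x) *\<^sub>R W x) \<bullet> h)) (at x)" for x
    using has_derivative_compose
      [OF w_smooth(2) has_real_derivative_soft_pos[OF k_pos, unfolded has_field_derivative_def]]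
    by simp
  have "{x. 1 / k \<le> w x} \<subseteq> {x. 0 < w x}"
    using k_pos by (auto intro: less_le_trans[of 0 "1 / k"])
  then show "{x. 1 / k \<le> w x} \<subseteq> \<Omega>"
    using superlevel(2) by (rule order_trans)
  show "soft_pos k (w x) = 0" if "x \<notin> {x. 1 / k \<le> w x}" for x
    using that k_pos by (simp add: soft_pos_eq_0)
qed

lemma H01_positive_part:
  assumes w_smooth: "smooth_fun w" "\<And>x. (w has_derivative (\<lambda>h. W x \<bullet> h)) (at x)"
    and superlevel: "\<And>d. 0 < d \<Longrightarrow> compact {x. d \<le> w x}" "{x. 0 < w x} \<subseteq> \<Omega>"
    and sq_integrable: "square_integrable lebesgue (\<lambda>x. max 0 (w x))"
      "square_integrable lebesgue (\<lambda>x. indicator {0<..} (w x) *\<^sub>R W x)"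
  shows "H01 \<Omega> (\<lambda>x. max 0 (w x)) (\<lambda>x. indicator {0<..} (w x) *\<^sub>R W x)"
proof (rule H01I[OF sq_integrable])
  let ?k = "\<lambda>n. real (Suc n)"
  let ?\<phi> = "\<lambda>n x. soft_pos (?k n) (w x)" and ?G = "\<lambda>n x. soft_step (?k n) (w x) *\<^sub>R W x"
  have k_pos: "0 < ?k n" for n by simp
  have lim_k: "filterlim ?k at_top sequentially"
    by (rule filterlim_compose[OF filterlim_real_sequentially filterlim_Suc])
  show test: "test_fun \<Omega> (?\<phi> n) (?G n)" for n
    by (intro test_fun_soft_pos w_smooth superlevel) simp_all
  show "tendsto_L2 lebesgue ?\<phi> (\<lambda>x. max 0 (w x))"
  proof (rule tendsto_L2_dominated[OF _ sq_integrable(1)])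
    show "?\<phi> n \<in> borel_measurable lebesgue" for n
      using test_fun_square_integrable(1)[OF test] by (rule square_integrable_measurable)
    show "norm (?\<phi> n x - max 0 (w x)) \<le> norm (max 0 (w x))" for n x
      using soft_pos_bounds[OF k_pos, of n "w x"] by simp
    show "(\<lambda>n. ?\<phi> n x) \<longlonglongrightarrow> max 0 (w x)" for x
      by (rule filterlim_compose[OF tendsto_soft(1) lim_k])
  qed
  show "tendsto_L2 lebesgue ?G (\<lambda>x. indicator {0<..} (w x) *\<^sub>R W x)"
  proof (rule tendsto_L2_dominated[OF _ sq_integrable(2)])
    show "?G n \<in> borel_measurable lebesgue" for n
      using test_fun_square_integrable(2)[OF test] by (rule square_integrable_measurable)
    show "norm (?G n x - indicator {0<..} (w x) *\<^sub>R W x) \<le> norm (indicator {0<..} (w x) *\<^sub>R W x)"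
      for n x
    proof -
      have "\<bar>soft_step (?k n) (w x) - indicator {0<..} (w x)\<bar> \<le> \<bar>indicator {0<..} (w x)\<bar>"
        using soft_step_bounds[OF k_pos, of n "w x"] by simp
      then show ?thesis
        by (simp only: norm_scaleR mult_right_mono norm_ge_zero flip: scaleR_left_diff_distrib)
    qed
    show "(\<lambda>n. ?G n x) \<longlonglongrightarrow> indicator {0<..} (w x) *\<^sub>R W x" for x
      by (intro tendsto_scaleR tendsto_const filterlim_compose[OF tendsto_soft(2) lim_k])
  qed
qed

section \<open>Torsion functions of disjoint unions\<close>

lemma torsion_imp_H01: "torsion \<Omega> v g \<Longrightarrow> H01 \<Omega> v g"
  by (simp add: torsion_def)

lemma torsion_set_integral_eq:
  "torsion \<Omega> v g \<Longrightarrow> test_fun \<Omega> \<psi> G \<Longrightarrow>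
    (\<integral>x\<in>\<Omega>. g x \<bullet> G x \<partial>lebesgue) = (\<integral>x\<in>\<Omega>. \<psi> x \<partial>lebesgue)"
  by (simp add: torsion_def)

lemma set_lebesgue_integral_add_Un_disjoint:
  fixes f g :: "'a \<Rightarrow> 'b::{banach, second_countable_topology}"
  assumes sets [measurable]: "A \<in> sets M" "B \<in> sets M" and disj: "A \<inter> B = {}"
    and summands_integrable: "integrable M f" "integrable M g"
    and zero: "AE x in M. x \<notin> A \<longrightarrow> f x = 0" "AE x in M. x \<notin> B \<longrightarrow> g x = 0"
  shows "(\<integral>x\<in>A \<union> B. f x + g x \<partial>M) = (\<integral>x\<in>A. f x \<partial>M) + (\<integral>x\<in>B. g x \<partial>M)"
proof -
  note [measurable] = summands_integrable[THEN borel_measurable_integrable]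
  have "(\<integral>x\<in>A \<union> B. f x + g x \<partial>M) = (\<integral>x. indicator A x *\<^sub>R f x + indicator B x *\<^sub>R g x \<partial>M)"
    unfolding set_lebesgue_integral_def
  proof (rule integral_cong_AE)
    show "AE x in M. indicator (A \<union> B) x *\<^sub>R (f x + g x) =
        indicator A x *\<^sub>R f x + indicator B x *\<^sub>R g x"
      using zero by eventually_elim (use disj in \<open>auto simp: indicator_def\<close>)
  qed measurable
  also have "\<dots> = (\<integral>x\<in>A. f x \<partial>M) + (\<integral>x\<in>B. g x \<partial>M)"
    unfolding set_lebesgue_integral_def
    by (intro Bochner_Integration.integral_add integrable_mult_indicator sets summands_integrable)
  finally show ?thesis .
qed

lemma torsion_set_integral_restrict:
  assumes "open U" "open V" "U \<inter> V = {}" "torsion U v g" "test_fun (U \<union> V) \<psi> G"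
  shows "(\<integral>x\<in>U. g x \<bullet> G x \<partial>lebesgue) = (\<integral>x\<in>U. \<psi> x \<partial>lebesgue)"
proof -
  have "(\<integral>x\<in>U. g x \<bullet> (indicator U x *\<^sub>R G x) \<partial>lebesgue) = (\<integral>x\<in>U. indicator U x * \<psi> x \<partial>lebesgue)"
    by (rule torsion_set_integral_eq[OF assms(4) test_fun_restrict[OF assms(1,2,3,5)]])
  then show ?thesis
    unfolding set_lebesgue_integral_def
    by (simp flip: mult.assoc indicator_inter_arith)
qed

lemma torsion_Un_disjoint:
  fixes U V :: "'a::euclidean_space set"
  assumes U_open: "open U" and V_open: "open V" and disj: "U \<inter> V = {}"
    and v_torsion: "torsion U v g" and w_torsion: "torsion V w h"
  shows "torsion (U \<union> V) (\<lambda>x. v x + w x) (\<lambda>x. g x + h x)"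
  unfolding torsion_def
proof (intro conjI allI impI)
  note H01 = v_torsion[THEN torsion_imp_H01] w_torsion[THEN torsion_imp_H01]
  show "H01 (U \<union> V) (\<lambda>x. v x + w x) (\<lambda>x. g x + h x)"
    using H01 by (intro H01_add) (auto elim: H01_mono)
  fix \<psi> G assume test: "test_fun (U \<union> V) \<psi> G"
  have sets: "U \<in> sets lebesgue" "V \<in> sets lebesgue"
    using U_open V_open by simp_all
  have sq_integrable: "square_integrable lebesgue g" "square_integrable lebesgue h"
    "square_integrable lebesgue G"
    using H01 test_fun_square_integrable(2)[OF test] by (simp_all add: H01_iff)
  have "(\<integral>x\<in>U \<union> V. g x \<bullet> G x + h x \<bullet> G x \<partial>lebesgue) =
      (\<integral>x\<in>U. g x \<bullet> G x \<partial>lebesgue) + (\<integral>x\<in>V. h x \<bullet> G x \<partial>lebesgue)"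
  proof (rule set_lebesgue_integral_add_Un_disjoint[OF sets disj])
    show "AE x in lebesgue. x \<notin> U \<longrightarrow> g x \<bullet> G x = 0" "AE x in lebesgue. x \<notin> V \<longrightarrow> h x \<bullet> G x = 0"
      using H01_AE_outside(2)[OF H01(1) sets(1)] H01_AE_outside(2)[OF H01(2) sets(2)]
      by (auto elim: eventually_mono)
  qed (intro square_integrable_inner sq_integrable)+
  also have "(\<integral>x\<in>U. g x \<bullet> G x \<partial>lebesgue) = (\<integral>x\<in>U. \<psi> x \<partial>lebesgue)"
    by (rule torsion_set_integral_restrict[OF U_open V_open disj v_torsion test])
  also have "(\<integral>x\<in>V. h x \<bullet> G x \<partial>lebesgue) = (\<integral>x\<in>V. \<psi> x \<partial>lebesgue)"
    using disj test
    by (intro torsion_set_integral_restrict[OF V_open U_open _ w_torsion])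
      (simp_all add: Un_commute Int_commute)
  also have "(\<integral>x\<in>U. \<psi> x \<partial>lebesgue) + (\<integral>x\<in>V. \<psi> x \<partial>lebesgue) = (\<integral>x\<in>U \<union> V. \<psi> x \<partial>lebesgue)"
    using integrable_mult_indicator[OF sets(1) test_fun_integrable[OF test]]
      integrable_mult_indicator[OF sets(2) test_fun_integrable[OF test]]
    by (intro set_integral_Un[symmetric] disj) (simp_all add: set_integrable_def)
  finally show "(\<integral>x\<in>U \<union> V. (g x + h x) \<bullet> G x \<partial>lebesgue) = (\<integral>x\<in>U \<union> V. \<psi> x \<partial>lebesgue)"
    by (simp add: inner_add_left)
qed

lemma torsion_empty: "torsion {} (\<lambda>_. 0) (\<lambda>_. 0)"
  by (simp add: torsion_def H01_zero set_lebesgue_integral_def)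

lemma torsion_UN_disjoint:
  assumes "finite I" "disjoint_family_on \<Omega> I" "\<And>i. i \<in> I \<Longrightarrow> open (\<Omega> i)"
    and "\<And>i. i \<in> I \<Longrightarrow> torsion (\<Omega> i) (v i) (g i)"
  shows "torsion (\<Union>i\<in>I. \<Omega> i) (\<lambda>x. \<Sum>i\<in>I. v i x) (\<lambda>x. \<Sum>i\<in>I. g i x)"
  using assms
proof (induction I rule: finite_induct)
  case (insert j I)
  have "\<Omega> j \<inter> (\<Union>i\<in>I. \<Omega> i) = {}"
    using insert.hyps insert.prems(1) by (auto simp: disjoint_family_on_def)
  moreover have "disjoint_family_on \<Omega> I"
    using insert.prems(1) by (rule disjoint_family_on_mono[rotated]) blast
  ultimately have "torsion (\<Omega> j \<union> (\<Union>i\<in>I. \<Omega> i))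
      (\<lambda>x. v j x + (\<Sum>i\<in>I. v i x)) (\<lambda>x. g j x + (\<Sum>i\<in>I. g i x))"
    using insert.prems by (intro torsion_Un_disjoint insert.IH open_UN ballI) auto
  then show ?case
    using insert.hyps by simp
qed (simp add: torsion_empty)

section \<open>Integration by parts\<close>

lemma has_real_derivative_along_line:
  fixes f :: "'a::real_normed_vector \<Rightarrow> real"
  assumes "\<And>x. (f has_derivative f' x) (at x)"
  shows "((\<lambda>t. f (x + t *\<^sub>R v)) has_real_derivative f' (x + t *\<^sub>R v) v) (at t)"
proof -
  have "((\<lambda>t. x + t *\<^sub>R v) has_derivative (\<lambda>s. s *\<^sub>R v)) (at t)"
    by (auto intro!: derivative_eq_intros)
  from has_derivative_compose[OF this assms] show ?thesis
    by (simp add: has_field_derivative_def linear_scale[OF has_derivative_linear[OF assms]]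
        mult_commute_abs)
qed

lemma abs_increment_le:
  fixes f :: "'a::real_normed_vector \<Rightarrow> real"
  assumes "\<And>x. (f has_derivative f' x) (at x)" and bound: "\<And>x. \<bar>f' x v\<bar> \<le> M" and "0 < t"
  shows "\<bar>f (x + t *\<^sub>R v) - f x\<bar> \<le> M * t"
proof -
  obtain z where "f (x + t *\<^sub>R v) - f (x + 0 *\<^sub>R v) = (t - 0) * f' (x + z *\<^sub>R v) v"
    using MVT2[OF \<open>0 < t\<close> has_real_derivative_along_line[OF assms(1)], of x v] by blast
  then show ?thesis
    using bound[of "x + z *\<^sub>R v"] \<open>0 < t\<close> by (simp add: abs_mult)
qed

lemma increment_eq_0_outside_cball:
  fixes f :: "'a::real_normed_vector \<Rightarrow> 'b::real_normed_vector"
  assumes supp: "{x. f x \<noteq> 0} \<subseteq> cball 0 R" and t_le_1: "\<bar>t\<bar> \<le> 1"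
    and x_outside: "x \<notin> cball 0 (R + norm v)"
  shows "f (x + t *\<^sub>R v) - f x = 0"
proof -
  have "norm (t *\<^sub>R v) \<le> norm v"
    using t_le_1 by (simp add: mult_left_le_one_le)
  then have "norm x \<le> norm (x + t *\<^sub>R v) + norm v"
    using norm_triangle_ineq4[of "x + t *\<^sub>R v" "t *\<^sub>R v"] by simp
  moreover have "R + norm v < norm x" using x_outside by simp
  ultimately have "R < norm x" "R < norm (x + t *\<^sub>R v)"
    using norm_ge_zero[of v] by linarith+
  then have "f x = 0" "f (x + t *\<^sub>R v) = 0"
    using supp by fastforce+
  then show ?thesis by simp
qed

lemma abs_difference_quotient_le:
  fixes f :: "'a::real_normed_vector \<Rightarrow> real"
  assumes "\<And>x. (f has_derivative f' x) (at x)" "\<And>x. \<bar>f' x v\<bar> \<le> M"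
    and "{x. f x \<noteq> 0} \<subseteq> cball 0 R" "0 < t" "t \<le> 1"
  shows "\<bar>(f (x + t *\<^sub>R v) - f x) / t\<bar> \<le> M * indicator (cball 0 (R + norm v)) x"
  using abs_increment_le[OF assms(1,2,4), of x] increment_eq_0_outside_cball[OF assms(3), of t x v]
    assms(4,5)
  by (cases "x \<in> cball 0 (R + norm v)") (simp_all add: divide_le_eq)

lemma continuous_bounded_support_imp_bounded:
  fixes f :: "'a::euclidean_space \<Rightarrow> 'b::real_normed_vector"
  assumes "continuous_on UNIV f" "bounded {x. f x \<noteq> 0}"
  shows "bounded (range f)"
proof (rule bounded_subset)
  show "bounded (insert 0 (f ` closure {x. f x \<noteq> 0}))"
    using assms unfolding bounded_insert
    by (intro compact_imp_bounded compact_continuous_image) (auto intro: continuous_on_subset)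
  show "range f \<subseteq> insert 0 (f ` closure {x. f x \<noteq> 0})"
    using closure_subset[of "{x. f x \<noteq> 0}"] by fastforce
qed

lemma integrable_lborel_translation:
  fixes f :: "'a::euclidean_space \<Rightarrow> 'b::{banach, second_countable_topology}"
  assumes "integrable lborel f"
  shows "integrable lborel (\<lambda>x. f (x + a))"
proof -
  have "integrable (distr lborel borel ((+) a)) f"
    using assms by (simp add: lborel_distr_plus)
  then show ?thesis
    using assms by (subst (asm) integrable_distr_eq) (simp_all add: add.commute)
qed

lemma integral_lborel_translation:
  fixes f :: "'a::euclidean_space \<Rightarrow> 'b::{banach, second_countable_topology}"
  assumes "f \<in> borel_measurable borel"
  shows "(\<integral>x. f (x + a) \<partial>lborel) = (\<integral>x. f x \<partial>lborel)"
  using integral_distr[of "(+) a" lborel borel f] assms by (simp add: lborel_distr_plus add.commute)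

lemma bounded_range_directional_derivative:
  fixes f :: "'a::euclidean_space \<Rightarrow> 'b::real_normed_vector"
  assumes deriv: "\<And>x. (f has_derivative f' x) (at x)"
    and "continuous_on UNIV (\<lambda>x. f' x v)" "bounded {x. f x \<noteq> 0}"
  shows "bounded (range (\<lambda>x. f' x v))"
proof (rule continuous_bounded_support_imp_bounded[OF assms(2)])
  have "{x. f' x v \<noteq> 0} \<subseteq> closure {x. f x \<noteq> 0}"
    using has_derivative_outside_support[OF deriv] by fastforce
  with bounded_closure[OF assms(3)] show "bounded {x. f' x v \<noteq> 0}"
    by (rule bounded_subset)
qed

lemma integral_directional_derivative_eq_0:
  fixes f :: "'a::euclidean_space \<Rightarrow> real"
  assumes deriv: "\<And>x. (f has_derivative f' x) (at x)"
    and cont: "continuous_on UNIV (\<lambda>x. f' x v)"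
    and supp: "bounded {x. f x \<noteq> 0}"
  shows "(\<integral>x. f' x v \<partial>lborel) = 0"
proof -
  define t where "t n = inverse (real (Suc n))" for n
  define q where "q n x = (f (x + t n *\<^sub>R v) - f x) / t n" for n x
  have t_bounds: "0 < t n" "t n \<le> 1" for n
    by (simp_all add: t_def inverse_le_1_iff)
  have lim_t: "filterlim t (at 0) sequentially"
    unfolding t_def[abs_def] by real_asymp
  have contf: "continuous_on UNIV f"
    by (intro continuous_at_imp_continuous_on ballI has_derivative_continuous[OF deriv])
  note [measurable] = contf[THEN borel_measurable_continuous_onI]
    cont[THEN borel_measurable_continuous_onI]
  have f_integrable: "integrable lborel f"
    by (rule integrable_continuous_bounded_support[OF contf supp])
  obtain R where support_subset: "{x. f x \<noteq> 0} \<subseteq> cball 0 R"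
    using supp by (auto simp: bounded_iff subset_iff)
  obtain M where deriv_bound: "\<And>x. \<bar>f' x v\<bar> \<le> M"
    using bounded_range_directional_derivative[OF deriv cont supp] by (auto simp: bounded_iff)
  have "(\<lambda>n. \<integral>x. q n x \<partial>lborel) \<longlonglongrightarrow> (\<integral>x. f' x v \<partial>lborel)"
  proof (rule integral_dominated_convergence)
    show "integrable lborel (\<lambda>x. M * indicator (cball 0 (R + norm v)) x :: real)"
      by (intro integrable_mult_right integrable_real_indicator)
        (simp_all add: emeasure_lborel_cball_finite[simplified])
    have "(\<lambda>n. q n x) \<longlonglongrightarrow> f' x v" for x
      using filterlim_compose[OF _ lim_t] has_real_derivative_along_line[OF deriv, of x v 0]
      by (simp add: DERIV_def q_def)
    then show "AE x in lborel. (\<lambda>n. q n x) \<longlonglongrightarrow> f' x v" by simp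
    show "AE x in lborel. norm (q n x) \<le> M * indicator (cball 0 (R + norm v)) x" for n
      unfolding q_def real_norm_def
      by (intro AE_I2 abs_difference_quotient_le[OF deriv deriv_bound support_subset t_bounds])
  qed (simp_all add: q_def)
  moreover have "(\<integral>x. q n x \<partial>lborel) = 0" for n
    by (simp add: q_def f_integrable integrable_lborel_translation integral_lborel_translation)
  ultimately show ?thesis
    by (simp add: LIMSEQ_const_iff)
qed

lemma integral_test_fun_radial_derivative:
  fixes c :: "'a::euclidean_space"
  assumes test: "test_fun \<Omega> \<psi> G"
  shows "(\<integral>x. G x \<bullet> (x - c) \<partial>lborel) = - real DIM('a) * (\<integral>x. \<psi> x \<partial>lborel)"
proof -
  note cont = test_fun_continuous_on[OF test, of UNIV] and supp = test_fun_bounded_support[OF test]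
  have test_integrable: "integrable lborel \<psi>"
    by (rule integrable_continuous_bounded_support[OF cont(1) supp(1)])
  have component_integrable: "integrable lborel (\<lambda>x. (G x \<bullet> b) * ((x - c) \<bullet> b))" for b
    using supp(2)
    by (intro integrable_continuous_bounded_support continuous_intros cont)
      (auto elim: bounded_subset)
  have by_parts: "(\<integral>x. (G x \<bullet> b) * ((x - c) \<bullet> b) \<partial>lborel) = - (\<integral>x. \<psi> x \<partial>lborel)"
    if "b \<in> Basis" for b
  proof -
    have "((\<lambda>x. \<psi> x * ((x - c) \<bullet> b)) has_derivative
        (\<lambda>h. \<psi> x * (h \<bullet> b) + (G x \<bullet> h) * ((x - c) \<bullet> b))) (at x)" for x
      by (auto intro!: derivative_eq_intros test_fun_has_derivative[OF test])
    then have "(\<integral>x. \<psi> x * (b \<bullet> b) + (G x \<bullet> b) * ((x - c) \<bullet> b) \<partial>lborel) = 0"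
    proof (rule integral_directional_derivative_eq_0)
      show "bounded {x. \<psi> x * ((x - c) \<bullet> b) \<noteq> 0}"
        using supp(1) by (auto elim: bounded_subset)
    qed (intro continuous_intros cont)
    with that test_integrable component_integrable show ?thesis by simp
  qed
  have "(\<integral>x. G x \<bullet> (x - c) \<partial>lborel) = (\<integral>x. (\<Sum>b\<in>Basis. (G x \<bullet> b) * ((x - c) \<bullet> b)) \<partial>lborel)"
    by (intro Bochner_Integration.integral_cong refl euclidean_inner)
  also have "\<dots> = - real DIM('a) * (\<integral>x. \<psi> x \<partial>lborel)"
    by (simp add: Bochner_Integration.integral_sum component_integrable by_parts)
  finally show ?thesis .
qed

section \<open>The torsion function of a ball\<close>

definition paraboloid :: "'a::euclidean_space \<Rightarrow> real \<Rightarrow> 'a \<Rightarrow> real" where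
  "paraboloid c r x = (r\<^sup>2 - (dist c x)\<^sup>2) / (2 * real DIM('a))"

definition ball_torsion :: "'a::euclidean_space \<Rightarrow> real \<Rightarrow> 'a \<Rightarrow> real" where
  "ball_torsion c r x = max 0 (paraboloid c r x)"

definition ball_torsion_grad :: "'a::euclidean_space \<Rightarrow> real \<Rightarrow> 'a \<Rightarrow> 'a" where
  "ball_torsion_grad c r x = indicator (ball c r) x *\<^sub>R ((c - x) /\<^sub>R real DIM('a))"

lemma paraboloid_pos_iff:
  assumes "0 < r"
  shows "0 < paraboloid c r x \<longleftrightarrow> x \<in> ball c r"
proof -
  have "0 < paraboloid c r x \<longleftrightarrow> (dist c x)\<^sup>2 < r\<^sup>2"
    by (simp add: paraboloid_def zero_less_divide_iff)
  also have "\<dots> \<longleftrightarrow> x \<in> ball c r"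
    using assms by (auto intro: power_strict_mono dest: power2_less_imp_less)
  finally show ?thesis .
qed

lemma smooth_fun_paraboloid:
  fixes c :: "'a::euclidean_space"
  shows "smooth_fun (paraboloid c r)"
proof -
  have "smooth_fun (\<lambda>x. 1 / (2 * real DIM('a)) * (r\<^sup>2 - (dist c x)\<^sup>2))"
    by (intro smooth_fun_cmult smooth_fun_diff smooth_fun_const smooth_fun_power2_dist)
  then show ?thesis
    by (simp add: paraboloid_def[abs_def])
qed

lemma has_derivative_paraboloid:
  fixes c :: "'a::euclidean_space"
  shows "(paraboloid c r has_derivative (\<lambda>h. ((c - x) /\<^sub>R real DIM('a)) \<bullet> h)) (at x)"
proof -
  have "paraboloid c r = (\<lambda>y. (r\<^sup>2 - (c - y) \<bullet> (c - y)) / (2 * real DIM('a)))"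
    by (simp add: fun_eq_iff paraboloid_def dist_norm power2_norm_eq_inner)
  then show ?thesis
    by (auto intro!: derivative_eq_intros
        simp: inner_commute inner_diff_left inner_diff_right field_simps)
qed

lemma ball_torsion_nonneg: "0 \<le> ball_torsion c r x"
  by (simp add: ball_torsion_def)

lemma ball_torsion_le:
  fixes c :: "'a::euclidean_space"
  assumes "0 < r"
  shows "ball_torsion c r x \<le> r\<^sup>2 * indicator (ball c r) x"
proof (cases "x \<in> ball c r")
  case True
  have "1 \<le> real DIM('a)"
    using DIM_ge_Suc0[where 'a='a] by (simp del: DIM_ge_Suc0)
  have "r\<^sup>2 - (dist c x)\<^sup>2 \<le> r\<^sup>2 * 1" by simp
  also have "\<dots> \<le> r\<^sup>2 * (2 * real DIM('a))"
    using \<open>1 \<le> real DIM('a)\<close> by (intro mult_left_mono zero_le_power2) linarith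
  finally show ?thesis
    using True by (simp add: ball_torsion_def paraboloid_def divide_le_eq)
next
  case False
  with paraboloid_pos_iff[OF assms, of c x] show ?thesis
    by (simp add: ball_torsion_def)
qed

lemma compact_paraboloid_ge:
  assumes "0 < r" "0 < d"
  shows "compact {x. d \<le> paraboloid c r x}"
proof -
  have "{x. d \<le> paraboloid c r x} \<subseteq> ball c r"
    using paraboloid_pos_iff[OF assms(1)] assms(2) by (auto simp del: mem_ball intro: less_le_trans)
  moreover have "closed {x. d \<le> paraboloid c r x}"
    by (intro closed_Collect_le continuous_on_const smooth_fun_continuous_on smooth_fun_paraboloid)
  ultimately show ?thesis
    by (simp add: compact_eq_bounded_closed bounded_subset[OF bounded_ball])
qed

lemma H01_ball_torsion:
  fixes c :: "'a::euclidean_space"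
  assumes "0 < r"
  shows "H01 (ball c r) (ball_torsion c r) (ball_torsion_grad c r)"
proof -
  let ?w = "paraboloid c r" and ?W = "\<lambda>x. (c - x) /\<^sub>R real DIM('a)"
  have pos: "{x. 0 < ?w x} = ball c r"
    using paraboloid_pos_iff[OF assms] by blast
  have grad: "ball_torsion_grad c r = (\<lambda>x. indicator {0<..} (?w x) *\<^sub>R ?W x)"
    using paraboloid_pos_iff[OF assms, of c]
    by (simp add: fun_eq_iff ball_torsion_grad_def indicator_def)
  have "{x. ball_torsion c r x \<noteq> 0} \<subseteq> ball c r"
    unfolding pos[symmetric] by (auto simp: ball_torsion_def)
  then have "square_integrable lebesgue (ball_torsion c r)"
    unfolding ball_torsion_def[abs_def]
    by (intro square_integrable_continuous_bounded_support continuous_intros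
        smooth_fun_continuous_on smooth_fun_paraboloid bounded_subset[OF bounded_ball])
  moreover have "square_integrable lebesgue (ball_torsion_grad c r)"
    unfolding ball_torsion_grad_def[abs_def]
    by (intro square_integrable_indicator_continuous continuous_intros) auto
  ultimately show ?thesis
    unfolding grad ball_torsion_def[abs_def]
    by (intro H01_positive_part smooth_fun_paraboloid has_derivative_paraboloid
        compact_paraboloid_ge assms) (simp_all add: pos)
qed

lemma torsion_ball:
  fixes c :: "'a::euclidean_space"
  assumes "0 < r"
  shows "torsion (ball c r) (ball_torsion c r) (ball_torsion_grad c r)"
  unfolding torsion_def
proof (intro conjI allI impI H01_ball_torsion assms)
  fix \<psi> :: "'a \<Rightarrow> real" and G assume test: "test_fun (ball c r) \<psi> G"
  note [measurable] = test_fun_continuous_on[OF test, THEN borel_measurable_continuous_onI]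
  have "indicator (ball c r) x *\<^sub>R (ball_torsion_grad c r x \<bullet> G x) =
      - (1 / real DIM('a)) * (G x \<bullet> (x - c))" for x
    using test_fun_outside(2)[OF test, of x]
    by (cases "x \<in> ball c r")
      (simp_all add: ball_torsion_grad_def inner_diff_left inner_diff_right inner_commute
        divide_simps)
  then have "(\<integral>x\<in>ball c r. ball_torsion_grad c r x \<bullet> G x \<partial>lebesgue) =
      - (1 / real DIM('a)) * (\<integral>x. G x \<bullet> (x - c) \<partial>lborel)"
    by (simp add: set_lebesgue_integral_def integral_completion)
  also have "\<dots> = (\<integral>x. \<psi> x \<partial>lborel)"
    by (simp add: integral_test_fun_radial_derivative[OF test])
  also have "\<dots> = (\<integral>x\<in>ball c r. \<psi> x \<partial>lebesgue)"
  proof -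
    have "indicator (ball c r) x *\<^sub>R \<psi> x = \<psi> x" for x
      using test_fun_outside(1)[OF test, of x] by (cases "x \<in> ball c r") simp_all
    then have "(\<integral>x\<in>ball c r. \<psi> x \<partial>lebesgue) = (\<integral>x. \<psi> x \<partial>lebesgue)"
      by (simp only: set_lebesgue_integral_def)
    then show ?thesis by (simp add: integral_completion)
  qed
  finally show "(\<integral>x\<in>ball c r. ball_torsion_grad c r x \<bullet> G x \<partial>lebesgue) =
      (\<integral>x\<in>ball c r. \<psi> x \<partial>lebesgue)" .
qed

section \<open>The first eigenvalue\<close>

definition rayleigh_quotients :: "'a::euclidean_space set \<Rightarrow> real set" where
  "rayleigh_quotients \<Omega> =
     {(\<integral>x\<in>\<Omega>. (norm (g x))\<^sup>2 \<partial>lebesgue) / (\<integral>x\<in>\<Omega>. (u x)\<^sup>2 \<partial>lebesgue) | u g.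
        H01 \<Omega> u g \<and> (\<integral>x\<in>\<Omega>. (u x)\<^sup>2 \<partial>lebesgue) \<noteq> 0}"

lemma lambda1_eq_Inf: "lambda1 \<Omega> = Inf (rayleigh_quotients \<Omega>)"
  by (simp add: lambda1_def rayleigh_quotients_def)

lemma rayleigh_quotients_nonneg: "x \<in> rayleigh_quotients \<Omega> \<Longrightarrow> 0 \<le> x"
  by (auto simp: rayleigh_quotients_def set_lebesgue_integral_def
      intro!: divide_nonneg_nonneg integral_nonneg_AE)

lemma set_lebesgue_integral_eq_superset:
  fixes f :: "'a \<Rightarrow> 'b::{banach, second_countable_topology}"
  assumes [measurable]: "A \<in> sets M" "B \<in> sets M" "f \<in> borel_measurable M"
    and "A \<subseteq> B" "AE x in M. x \<notin> A \<longrightarrow> f x = 0"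
  shows "(\<integral>x\<in>A. f x \<partial>M) = (\<integral>x\<in>B. f x \<partial>M)"
  unfolding set_lebesgue_integral_def
proof (rule integral_cong_AE)
  show "AE x in M. indicator A x *\<^sub>R f x = indicator B x *\<^sub>R f x"
    using assms(5) by eventually_elim (use assms(4) in \<open>auto simp: indicator_def\<close>)
qed measurable

lemma rayleigh_quotients_mono:
  assumes "\<Omega> \<subseteq> \<Omega>'" and sets [measurable]: "\<Omega> \<in> sets lebesgue" "\<Omega>' \<in> sets lebesgue"
  shows "rayleigh_quotients \<Omega> \<subseteq> rayleigh_quotients \<Omega>'"
proof
  fix q assume "q \<in> rayleigh_quotients \<Omega>"
  then obtain u g where H01: "H01 \<Omega> u g" and "(\<integral>x\<in>\<Omega>. (u x)\<^sup>2 \<partial>lebesgue) \<noteq> 0"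
    and "q = (\<integral>x\<in>\<Omega>. (norm (g x))\<^sup>2 \<partial>lebesgue) / (\<integral>x\<in>\<Omega>. (u x)\<^sup>2 \<partial>lebesgue)"
    unfolding rayleigh_quotients_def by blast
  moreover have [measurable]: "u \<in> borel_measurable lebesgue" "g \<in> borel_measurable lebesgue"
    using H01 by (simp_all add: H01_def)
  have "(\<integral>x\<in>\<Omega>. (u x)\<^sup>2 \<partial>lebesgue) = (\<integral>x\<in>\<Omega>'. (u x)\<^sup>2 \<partial>lebesgue)"
    using H01_AE_outside(1)[OF H01 sets(1)]
    by (intro set_lebesgue_integral_eq_superset assms(1) sets) auto
  moreover have "(\<integral>x\<in>\<Omega>. (norm (g x))\<^sup>2 \<partial>lebesgue) = (\<integral>x\<in>\<Omega>'. (norm (g x))\<^sup>2 \<partial>lebesgue)"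
    using H01_AE_outside(2)[OF H01 sets(1)]
    by (intro set_lebesgue_integral_eq_superset assms(1) sets) auto
  moreover have "H01 \<Omega>' u g"
    using H01 assms(1) by (rule H01_mono)
  ultimately show "q \<in> rayleigh_quotients \<Omega>'"
    unfolding rayleigh_quotients_def by auto
qed

lemma rayleigh_quotients_nonempty:
  fixes \<Omega> :: "'a::euclidean_space set"
  assumes "open \<Omega>" "\<Omega> \<noteq> {}"
  shows "rayleigh_quotients \<Omega> \<noteq> {}"
proof -
  obtain c r where r_pos: "0 < r" and sub: "ball c r \<subseteq> \<Omega>"
    using assms open_contains_ball by blast
  let ?u = "ball_torsion c r"
  have ball_integrable: "integrable lebesgue (\<lambda>x. indicator (ball c r) x *\<^sub>R (?u x)\<^sup>2)"
    using H01_ball_torsion[OF r_pos, of c]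
    by (intro integrable_mult_indicator) (simp_all add: H01_def)
  have "(\<integral>x\<in>ball c r. (?u x)\<^sup>2 \<partial>lebesgue) \<noteq> 0"
  proof
    assume "(\<integral>x\<in>ball c r. (?u x)\<^sup>2 \<partial>lebesgue) = 0"
    then have "AE x in lebesgue. indicator (ball c r) x *\<^sub>R (?u x)\<^sup>2 = 0"
      using integral_nonneg_eq_0_iff_AE[OF ball_integrable] by (simp add: set_lebesgue_integral_def)
    then have "AE x in lebesgue. x \<notin> ball c r"
    proof eventually_elim
      case (elim x)
      then show ?case
        using paraboloid_pos_iff[OF r_pos, of c x] by (auto simp: ball_torsion_def)
    qed
    then have "negligible (ball c r)"
      by (simp add: negligible_iff_null_sets AE_iff_null_sets)
    with open_not_negligible[of "ball c r"] r_pos show False by simp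
  qed
  with H01_ball_torsion[OF r_pos] have "rayleigh_quotients (ball c r) \<noteq> {}"
    unfolding rayleigh_quotients_def by blast
  with rayleigh_quotients_mono[OF sub] assms(1) show ?thesis by auto
qed

lemma lambda1_nonneg:
  assumes "open \<Omega>" "\<Omega> \<noteq> {}"
  shows "0 \<le> lambda1 \<Omega>"
  unfolding lambda1_eq_Inf
  using rayleigh_quotients_nonempty[OF assms] rayleigh_quotients_nonneg by (rule cInf_greatest)

lemma lambda1_antimono:
  assumes "open \<Omega>" "\<Omega> \<noteq> {}" "open \<Omega>'" "\<Omega> \<subseteq> \<Omega>'"
  shows "lambda1 \<Omega>' \<le> lambda1 \<Omega>"
  unfolding lambda1_eq_Inf
proof (rule cInf_superset_mono)
  show "rayleigh_quotients \<Omega> \<noteq> {}"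
    using assms(1,2) by (rule rayleigh_quotients_nonempty)
  show "bdd_below (rayleigh_quotients \<Omega>')"
    using rayleigh_quotients_nonneg by (rule bdd_belowI)
  show "rayleigh_quotients \<Omega> \<subseteq> rayleigh_quotients \<Omega>'"
    using assms by (intro rayleigh_quotients_mono) simp_all
qed

section \<open>Disjoint unions of balls\<close>

lemma powr_sum_ball_torsion_le:
  fixes c :: "'i \<Rightarrow> 'a::euclidean_space"
  assumes finite_I: "finite I" and disj: "disjoint_family_on (\<lambda>i. ball (c i) (r i)) I"
    and r_pos: "\<And>i. i \<in> I \<Longrightarrow> 0 < r i" and p_nonneg: "0 \<le> p"
    and x_in_UN: "x \<in> (\<Union>i\<in>I. ball (c i) (r i))"
  shows "\<bar>\<Sum>i\<in>I. ball_torsion (c i) (r i) x\<bar> powr p \<le>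
    (\<Sum>i\<in>I. r i powr (2 * p) * indicator (ball (c i) (r i)) x)"
proof -
  obtain k where x_in_ball: "k \<in> I" "x \<in> ball (c k) (r k)" using x_in_UN by blast
  note single = sum_indicator_disjoint_family[OF disj x_in_ball(2) finite_I x_in_ball(1)]
  have "(\<Sum>i\<in>I. ball_torsion (c i) (r i) x) \<le> (\<Sum>i\<in>I. (r i)\<^sup>2 * indicator (ball (c i) (r i)) x)"
    by (intro sum_mono ball_torsion_le r_pos)
  also have "\<dots> = (r k)\<^sup>2" by (rule single)
  finally have "\<bar>\<Sum>i\<in>I. ball_torsion (c i) (r i) x\<bar> powr p \<le> ((r k)\<^sup>2) powr p"
    using p_nonneg by (intro powr_mono2) (simp_all add: sum_nonneg ball_torsion_nonneg)
  also have "\<dots> = r k powr (2 * p)"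
    using r_pos[OF x_in_ball(1)] by (simp add: powr_powr flip: powr_numeral)
  also have "\<dots> = (\<Sum>i\<in>I. r i powr (2 * p) * indicator (ball (c i) (r i)) x)"
    by (rule single[symmetric])
  finally show ?thesis .
qed

lemma integral_powr_sum_ball_torsion_le:
  fixes c :: "'i \<Rightarrow> 'a::euclidean_space"
  assumes "finite I" "disjoint_family_on (\<lambda>i. ball (c i) (r i)) I"
    and "\<And>i. i \<in> I \<Longrightarrow> 0 < r i" and "0 \<le> p"
  shows "(\<integral>x\<in>(\<Union>i\<in>I. ball (c i) (r i)). \<bar>\<Sum>i\<in>I. ball_torsion (c i) (r i) x\<bar> powr p \<partial>lebesgue) \<le>
    (\<Sum>i\<in>I. r i powr (2 * p) * measure lebesgue (ball (c i) (r i)))"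
proof -
  let ?B = "\<lambda>i. ball (c i) (r i)"
  have summand_integrable: "integrable lebesgue (\<lambda>x. r i powr (2 * p) * indicator (?B i) x)" for i
    by (intro integrable_mult_right integrable_real_indicator)
      (simp_all add: emeasure_lborel_ball_finite[simplified])
  have "(\<integral>x\<in>(\<Union>i\<in>I. ?B i). \<bar>\<Sum>i\<in>I. ball_torsion (c i) (r i) x\<bar> powr p \<partial>lebesgue) \<le>
      (\<integral>x. (\<Sum>i\<in>I. r i powr (2 * p) * indicator (?B i) x) \<partial>lebesgue)"
    unfolding set_lebesgue_integral_def
  proof (rule integral_mono')
    show "integrable lebesgue (\<lambda>x. \<Sum>i\<in>I. r i powr (2 * p) * indicator (?B i) x)"
      by (intro Bochner_Integration.integrable_sum summand_integrable)
    show nonneg: "0 \<le> (\<Sum>i\<in>I. r i powr (2 * p) * indicator (?B i) x)" for x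
      by (intro sum_nonneg) simp
    show "indicator (\<Union>i\<in>I. ?B i) x *\<^sub>R \<bar>\<Sum>i\<in>I. ball_torsion (c i) (r i) x\<bar> powr p \<le>
        (\<Sum>i\<in>I. r i powr (2 * p) * indicator (?B i) x)" for x
      using powr_sum_ball_torsion_le[OF assms] nonneg[of x] by (cases "x \<in> (\<Union>i\<in>I. ?B i)") simp_all
  qed
  also have "\<dots> = (\<Sum>i\<in>I. r i powr (2 * p) * measure lebesgue (?B i))"
    by (simp only: Bochner_Integration.integral_sum summand_integrable) simp
  finally show ?thesis .
qed

lemma measure_UN_disjoint_balls:
  fixes c :: "'i \<Rightarrow> 'a::euclidean_space"
  assumes "finite I" "disjoint_family_on (\<lambda>i. ball (c i) (r i)) I" "\<And>i. i \<in> I \<Longrightarrow> 0 < r i"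
  shows "measure lebesgue (\<Union>i\<in>I. ball (c i) (r i)) =
    unit_ball_vol (real DIM('a)) * (\<Sum>i\<in>I. r i ^ DIM('a))"
proof -
  have "measure lebesgue (\<Union>i\<in>I. ball (c i) (r i)) = (\<Sum>i\<in>I. measure lebesgue (ball (c i) (r i)))"
    using assms(1,2)
    by (intro measure_finite_Union)
      (auto simp: emeasure_lborel_ball_finite[THEN less_imp_neq, simplified])
  also have "\<dots> = (\<Sum>i\<in>I. unit_ball_vol (real DIM('a)) * r i ^ DIM('a))"
    using assms(3) by (intro sum.cong refl) (simp add: content_ball less_imp_le)
  finally show ?thesis by (simp add: sum_distrib_left)
qed

lemma Fp_of_sum_ball_torsion_le:
  fixes c :: "'i \<Rightarrow> 'a::euclidean_space"
  assumes I_finite: "finite I" "I \<noteq> {}" and disj: "disjoint_family_on (\<lambda>i. ball (c i) (r i)) I"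
    and r_pos: "\<And>i. i \<in> I \<Longrightarrow> 0 < r i" and p_pos: "0 < p"
  defines "\<Omega> \<equiv> \<Union>i\<in>I. ball (c i) (r i)"
  shows "Fp_of p \<Omega> (\<lambda>x. \<Sum>i\<in>I. ball_torsion (c i) (r i) x) \<le>
    lambda1 \<Omega> * ((\<Sum>i\<in>I. r i powr (2 * p) * r i ^ DIM('a)) / (\<Sum>i\<in>I. r i ^ DIM('a))) powr (1 / p)"
proof -
  let ?v = "\<lambda>x. \<Sum>i\<in>I. ball_torsion (c i) (r i) x"
  let ?S = "\<Sum>i\<in>I. r i powr (2 * p) * r i ^ DIM('a)" and ?V = "\<Sum>i\<in>I. r i ^ DIM('a)"
  define \<omega> where "\<omega> = unit_ball_vol (real DIM('a))"
  have \<omega>_pos: "0 < \<omega>" by (simp add: \<omega>_def)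
  have vol: "measure lebesgue \<Omega> = \<omega> * ?V"
    unfolding \<Omega>_def \<omega>_def by (rule measure_UN_disjoint_balls[OF I_finite(1) disj r_pos])
  have "(\<integral>x\<in>\<Omega>. \<bar>?v x\<bar> powr p \<partial>lebesgue) \<le>
      (\<Sum>i\<in>I. r i powr (2 * p) * measure lebesgue (ball (c i) (r i)))"
    unfolding \<Omega>_def using p_pos
    by (intro integral_powr_sum_ball_torsion_le I_finite disj r_pos) simp_all
  also have "\<dots> = (\<Sum>i\<in>I. \<omega> * (r i powr (2 * p) * r i ^ DIM('a)))"
    using r_pos by (intro sum.cong refl) (simp add: content_ball less_imp_le \<omega>_def)
  finally have integral_le: "(\<integral>x\<in>\<Omega>. \<bar>?v x\<bar> powr p \<partial>lebesgue) \<le> \<omega> * ?S"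
    by (simp add: sum_distrib_left)
  have integral_nonneg: "0 \<le> (\<integral>x\<in>\<Omega>. \<bar>?v x\<bar> powr p \<partial>lebesgue)"
    by (simp add: set_lebesgue_integral_def)
  have "open \<Omega>" "\<Omega> \<noteq> {}"
    using I_finite(2) r_pos by (force simp: \<Omega>_def)+
  with integral_le integral_nonneg p_pos
  have "Fp_of p \<Omega> ?v \<le> (\<omega> * ?S) powr (1 / p) * lambda1 \<Omega> / (\<omega> * ?V) powr (1 / p)"
    unfolding Fp_of_def vol
    by (intro divide_right_mono mult_right_mono powr_mono2 lambda1_nonneg) simp_all
  also have "\<dots> = lambda1 \<Omega> * ((\<omega> * ?S) / (\<omega> * ?V)) powr (1 / p)"
    using \<omega>_pos r_pos by (subst powr_divide) (simp_all add: sum_nonneg less_imp_le)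
  also have "(\<omega> * ?S) / (\<omega> * ?V) = ?S / ?V"
    using \<omega>_pos by simp
  finally show ?thesis .
qed

section \<open>The unit ball with many small balls\<close>

definition row_centre :: "nat \<Rightarrow> 'a::euclidean_space" where
  "row_centre i = (2 * real i) *\<^sub>R (SOME b. b \<in> Basis)"

definition dust_radius :: "nat \<Rightarrow> nat \<Rightarrow> real" where
  "dust_radius j i = (if i = 0 then 1 else 1 / real j)"

definition dusty_ball :: "nat \<Rightarrow> 'a::euclidean_space set" where
  "dusty_ball j = (\<Union>i\<le>j ^ (DIM('a) + 1). ball (row_centre i) (dust_radius j i))"

definition dusty_ball_torsion :: "nat \<Rightarrow> 'a::euclidean_space \<Rightarrow> real" where
  "dusty_ball_torsion j x = (\<Sum>i\<le>j ^ (DIM('a) + 1). ball_torsion (row_centre i) (dust_radius j i) x)"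

lemma disjoint_row_balls:
  assumes "\<And>i. i \<in> I \<Longrightarrow> r i \<le> 1"
  shows "disjoint_family_on (\<lambda>i. ball (row_centre i :: 'a::euclidean_space) (r i)) I"
  unfolding disjoint_family_on_def
proof (intro ballI impI)
  fix i k assume "i \<in> I" "k \<in> I" "i \<noteq> k"
  have separated: "1 \<le> \<bar>real i - real k\<bar>"
    using \<open>i \<noteq> k\<close> by linarith
  have "r i + r k \<le> 2 * 1"
    using assms[OF \<open>i \<in> I\<close>] assms[OF \<open>k \<in> I\<close>] by simp
  also have "\<dots> \<le> \<bar>2 * real i - 2 * real k\<bar>"
    using separated by linarith
  also have "\<dots> = norm ((2 * real i - 2 * real k) *\<^sub>R (SOME b. b \<in> Basis) :: 'a)"
    by (simp add: SOME_Basis)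
  also have "\<dots> = dist (row_centre i) (row_centre k :: 'a)"
    by (simp only: row_centre_def dist_norm scaleR_left_diff_distrib)
  finally show "ball (row_centre i :: 'a) (r i) \<inter> ball (row_centre k) (r k) = {}"
    by (rule disjoint_ballI)
qed

lemma dust_radius_pos: "0 < j \<Longrightarrow> 0 < dust_radius j i"
  by (simp add: dust_radius_def)

lemma dust_radius_le_1: "0 < j \<Longrightarrow> dust_radius j i \<le> 1"
  by (simp add: dust_radius_def)

lemma sum_dust_radius: "(\<Sum>i\<le>n. f (dust_radius j i)) = f 1 + real n * f (1 / real j)"
  for f :: "real \<Rightarrow> real"
  by (simp add: sum.atMost_shift dust_radius_def)

lemma dust_radius_mean_le:
  assumes "0 < j" "1 / 2 \<le> p"
  shows "(\<Sum>i\<le>j ^ (m + 1). dust_radius j i powr (2 * p) * dust_radius j i ^ m) /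
    (\<Sum>i\<le>j ^ (m + 1). dust_radius j i ^ m) \<le> 2 / (1 + real j)"
proof -
  have total: "real (j ^ (m + 1)) * (1 / real j) ^ m = real j"
    using assms(1) by (simp add: power_divide)
  have "(1 / real j) powr (2 * p) \<le> (1 / real j) powr 1"
    using assms by (intro powr_mono') simp_all
  then have "real j * (1 / real j) powr (2 * p) \<le> real j * (1 / real j)"
    using assms(1) by (intro mult_left_mono) simp_all
  also have "\<dots> = 1" using assms(1) by simp
  finally have small: "real j * (1 / real j) powr (2 * p) \<le> 1" .
  have "(\<Sum>i\<le>j ^ (m + 1). dust_radius j i ^ m) = 1 + real j"
    by (subst sum_dust_radius[of "\<lambda>s. s ^ m"]) (simp only: total power_one)
  moreover have "(\<Sum>i\<le>j ^ (m + 1). dust_radius j i powr (2 * p) * dust_radius j i ^ m) =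
      1 + real (j ^ (m + 1)) * (1 / real j) ^ m * (1 / real j) powr (2 * p)"
    by (subst sum_dust_radius[of "\<lambda>s. s powr (2 * p) * s ^ m"]) simp
  ultimately show ?thesis
    using small unfolding total by (simp add: divide_right_mono)
qed

lemma disjoint_dusty_balls:
  "0 < j \<Longrightarrow> disjoint_family_on (\<lambda>i. ball (row_centre i) (dust_radius j i)) I"
  by (intro disjoint_row_balls dust_radius_le_1)

lemma open_dusty_ball: "open (dusty_ball j)"
  by (auto simp: dusty_ball_def)

lemma bounded_dusty_ball: "bounded (dusty_ball j)"
  by (auto simp: dusty_ball_def)

lemma ball_subset_dusty_ball: "ball 0 1 \<subseteq> dusty_ball j"
proof -
  have "ball (row_centre 0 :: 'a) (dust_radius j 0) \<subseteq> dusty_ball j"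
    unfolding dusty_ball_def by blast
  then show ?thesis by (simp add: row_centre_def dust_radius_def)
qed

lemma measure_dusty_ball_pos: "0 < measure lebesgue (dusty_ball j :: 'a::euclidean_space set)"
proof -
  have "ball 0 1 \<subseteq> (dusty_ball j :: 'a set)" by (rule ball_subset_dusty_ball)
  then have "\<not> negligible (dusty_ball j :: 'a set)"
    by (intro open_not_negligible open_dusty_ball) auto
  then show ?thesis
    by (simp add: negligible_iff_measure0 lmeasurable_open bounded_dusty_ball open_dusty_ball
        zero_less_measure_iff)
qed

lemma emeasure_dusty_ball_finite: "emeasure lebesgue (dusty_ball j) < \<infinity>"
  using emeasure_bounded_finite[OF bounded_dusty_ball] by (simp add: open_dusty_ball)

lemma torsion_dusty_ball:
  assumes "0 < j"
  shows "\<exists>g. torsion (dusty_ball j) (dusty_ball_torsion j) (g :: 'a::euclidean_space \<Rightarrow> 'a)"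
proof
  show "torsion (dusty_ball j) (dusty_ball_torsion j)
      (\<lambda>x :: 'a. \<Sum>i\<le>j ^ (DIM('a) + 1). ball_torsion_grad (row_centre i) (dust_radius j i) x)"
    unfolding dusty_ball_def dusty_ball_torsion_def[abs_def] using assms
    by (intro torsion_UN_disjoint disjoint_dusty_balls torsion_ball dust_radius_pos) auto
qed

lemma Fp_of_dusty_ball_le:
  assumes "0 < j" "1 / 2 \<le> p"
  shows "Fp_of p (dusty_ball j) (dusty_ball_torsion j :: 'a::euclidean_space \<Rightarrow> real) \<le>
    lambda1 (ball (0::'a) 1) * (2 / (1 + real j)) powr (1 / p)"
proof -
  let ?I = "{..j ^ (DIM('a) + 1)}" and ?r = "dust_radius j"
  let ?mean = "(\<Sum>i\<in>?I. ?r i powr (2 * p) * ?r i ^ DIM('a)) / (\<Sum>i\<in>?I. ?r i ^ DIM('a))"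
  have "Fp_of p (dusty_ball j) (dusty_ball_torsion j :: 'a \<Rightarrow> real) \<le>
      lambda1 (dusty_ball j :: 'a set) * ?mean powr (1 / p)"
    unfolding dusty_ball_def dusty_ball_torsion_def[abs_def] using assms
    by (intro Fp_of_sum_ball_torsion_le disjoint_dusty_balls dust_radius_pos) auto
  also have "\<dots> \<le> lambda1 (ball (0::'a) 1) * (2 / (1 + real j)) powr (1 / p)"
  proof (intro mult_mono powr_mono2)
    show "lambda1 (dusty_ball j :: 'a set) \<le> lambda1 (ball (0::'a) 1)"
      by (intro lambda1_antimono open_dusty_ball ball_subset_dusty_ball) simp_all
    show "?mean \<le> 2 / (1 + real j)"
      using assms by (rule dust_radius_mean_le)
    show "0 \<le> lambda1 (ball (0::'a) 1)"
      by (intro lambda1_nonneg) simp_all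
    show "0 \<le> ?mean"
      using dust_radius_pos[OF assms(1)]
      by (intro divide_nonneg_nonneg sum_nonneg mult_nonneg_nonneg zero_le_power)
        (simp_all add: less_imp_le)
  qed (use assms in simp_all)
  finally show ?thesis .
qed

lemma Fp_of_nonneg:
  assumes "open \<Omega>" "\<Omega> \<noteq> {}"
  shows "0 \<le> Fp_of p \<Omega> v"
  unfolding Fp_of_def
  by (intro divide_nonneg_nonneg mult_nonneg_nonneg lambda1_nonneg assms) simp_all

theorem theorem2:
  fixes p :: real
  assumes "1 \<le> p"
  shows "Inf {Fp_of p \<Omega> v | (\<Omega> :: 'a::euclidean_space set) v g.
            open \<Omega> \<and> 0 < measure lebesgue \<Omega> \<and> emeasure lebesgue \<Omega> < \<infinity> \<and> torsion \<Omega> v g} = 0"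
    (is "Inf ?S = 0")
proof (rule antisym)
  let ?bound = "\<lambda>j. lambda1 (ball (0::'a) 1) * (2 / (1 + real (Suc j))) powr (1 / p)"
  have nonneg: "0 \<le> y" if "y \<in> ?S" for y
    using that Fp_of_nonneg by fastforce
  have attained: "Fp_of p (dusty_ball (Suc j)) (dusty_ball_torsion (Suc j) :: 'a \<Rightarrow> real) \<in> ?S" for j
    using torsion_dusty_ball[of "Suc j"] open_dusty_ball measure_dusty_ball_pos
      emeasure_dusty_ball_finite by blast
  then show "0 \<le> Inf ?S"
    using nonneg by (intro cInf_greatest) blast+
  have "Inf ?S \<le> ?bound j" for j
  proof -
    have "Inf ?S \<le> Fp_of p (dusty_ball (Suc j)) (dusty_ball_torsion (Suc j) :: 'a \<Rightarrow> real)"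
      using attained nonneg by (intro cInf_lower bdd_belowI)
    also have "\<dots> \<le> ?bound j"
      using assms by (intro Fp_of_dusty_ball_le) simp_all
    finally show ?thesis .
  qed
  moreover have "(\<lambda>j. 2 / (1 + real (Suc j))) \<longlonglongrightarrow> 0"
    by real_asymp
  then have "?bound \<longlonglongrightarrow> 0"
    using assms by (intro tendsto_mult_right_zero tendsto_zero_powrI[OF _ tendsto_const]) simp_all
  ultimately show "Inf ?S \<le> 0"
    by (intro LIMSEQ_le_const) auto
qed

end
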